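(* Let $K$ be a field, $n\ge1$, and $R_n=R(K[X_1,\ldots,X_n])$. For every integer $i$ with $1\le i\le n-1$, there exist infinitely many prime ideals of $R_n$ of height $i$.
   Context: For an integral domain $T$, the reciprocal complement $R(T)$ is the subring of the fraction field of $T$ generated by all $1/f$ with $f\in T\setminus\{0\}$. Here $K[X_1,\ldots,X_n]$ is the polynomial ring in $n$ variables over $K$. *)

theory Defs
  imports
    "HOL-Library.Poly_Mapping"
    "HOL-Library.Extended_Nat"
    "HOL-Computational_Algebra.Fraction_Field"
    "HOL-Algebra.Generated_Rings"
    "HOL-Algebra.Algebraic_Closure_Type"
begin

text \<open>Polynomials over \<open>'k\<close> are finitely supported maps from monomials to coefficients, a monomial
  being a finitely supported map from variable indices to exponents. So that the number of variables
  can be an arbitrary natural number \<open>n\<close>, \<open>K[X\<^sub>1,\<dots>,X\<^sub>n]\<close> is the set of those polynomials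
  in countably many variables that involve only variables with index in \<open>{1..n}\<close>.\<close>

definition polynomials_in :: "nat \<Rightarrow> ((nat \<Rightarrow>\<^sub>0 nat) \<Rightarrow>\<^sub>0 'k::comm_ring_1) set"
  where "polynomials_in n = {p. \<forall>m \<in> Poly_Mapping.keys p. Poly_Mapping.keys m \<subseteq> {1..n}}"

text \<open>In the next two definitions \<open>T\<close> is meant to be a subring of an integral domain \<open>'a\<close>. Its
  fraction field is realized inside that of \<open>'a\<close>.\<close>

definition fraction_field :: "'a::idom set \<Rightarrow> 'a fract ring"
  where "fraction_field T =
    ring_of_type_algebra\<lparr>carrier := {Fract a b |a b. a \<in> T \<and> b \<in> T \<and> b \<noteq> 0}\<rparr>"

definition reciprocal_complement :: "'a::idom set \<Rightarrow> 'a fract ring"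
  where "reciprocal_complement T =
    (fraction_field T)\<lparr>carrier := generate_ring (fraction_field T) {Fract 1 f |f. f \<in> T \<and> f \<noteq> 0}\<rparr>"

text \<open>The supremum of the lengths \<open>k\<close> of chains \<open>C 0 \<subset> \<dots> \<subset> C k = P\<close> of prime ideals; only meaningful
  for a prime ideal \<open>P\<close> of \<open>R\<close>.\<close>

definition ideal_height :: "('a, 'b) ring_scheme \<Rightarrow> 'a set \<Rightarrow> enat"
  where "ideal_height R P =
    (SUP k \<in> {k. \<exists>C. (\<forall>j\<le>k. primeideal (C j) R) \<and> (\<forall>j<k. C j \<subset> C (Suc j)) \<and> C k = P}. enat k)"

lemma ring_of_type_algebra_sel [simp]:
  "carrier ring_of_type_algebra = UNIV"
  "x \<otimes>\<^bsub>ring_of_type_algebra\<^esub> y = x * y"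
  "x \<oplus>\<^bsub>ring_of_type_algebra\<^esub> y = x + y"
  "\<one>\<^bsub>ring_of_type_algebra\<^esub> = 1"
  "\<zero>\<^bsub>ring_of_type_algebra\<^esub> = 0"
  by (simp_all add: ring_of_type_algebra_def)

lemma a_inv_ring_of_type_algebra [simp]:
  "\<ominus>\<^bsub>ring_of_type_algebra\<^esub> (x::'a::comm_ring_1) = - x"
proof -
  interpret cring "ring_of_type_algebra :: 'a ring" by (rule cring_from_type_algebra)
  show ?thesis by (rule minus_equality) auto
qed

lemma keys_minus_eq: "Poly_Mapping.keys (- p) = Poly_Mapping.keys (p :: 'a \<Rightarrow>\<^sub>0 'b::ab_group_add)"
  by (auto simp: in_keys_iff)

lemma subring_polynomials_in:
  "subring (polynomials_in n :: ((nat \<Rightarrow>\<^sub>0 nat) \<Rightarrow>\<^sub>0 'k::comm_ring_1) set) ring_of_type_algebra"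
proof -
  interpret cring "ring_of_type_algebra :: ((nat \<Rightarrow>\<^sub>0 nat) \<Rightarrow>\<^sub>0 'k) ring"
    by (rule cring_from_type_algebra)
  show ?thesis
  proof (rule subringI)
    fix p q :: "(nat \<Rightarrow>\<^sub>0 nat) \<Rightarrow>\<^sub>0 'k"
    assume p: "p \<in> polynomials_in n" and q: "q \<in> polynomials_in n"
    have "Poly_Mapping.keys m \<subseteq> {1..n}" if m: "m \<in> Poly_Mapping.keys (p * q)" for m
    proof -
      obtain a b where "m = a + b" "a \<in> Poly_Mapping.keys p" "b \<in> Poly_Mapping.keys q"
        using keys_mult[of p q] m by blast
      with p q keys_add[of a b] show ?thesis
        unfolding polynomials_in_def by blast
    qed
    then show "p \<otimes>\<^bsub>ring_of_type_algebra\<^esub> q \<in> polynomials_in n"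
      by (simp add: polynomials_in_def)
    show "p \<oplus>\<^bsub>ring_of_type_algebra\<^esub> q \<in> polynomials_in n"
      using p q keys_add[of p q] unfolding polynomials_in_def by auto
  qed (auto simp: polynomials_in_def keys_minus_eq)
qed

lemma field_fraction_field:
  fixes T :: "'a::idom set"
  assumes "subring T ring_of_type_algebra"
  shows "field (fraction_field T)"
proof -
  interpret F: field "ring_of_type_algebra :: 'a fract ring" by (rule field_from_type_algebra)
  note T = subringE[OF assms, simplified]
  let ?F = "{Fract a b |a b. a \<in> T \<and> b \<in> T \<and> b \<noteq> 0}"
  have sub: "subcring ?F ring_of_type_algebra"
  proof (rule F.subcringI'[OF F.subringI])
    show "\<one>\<^bsub>ring_of_type_algebra\<^esub> \<in> ?F"
      using T(3) by (force simp: One_fract_def)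
    show "\<ominus>\<^bsub>ring_of_type_algebra\<^esub> h \<in> ?F" if "h \<in> ?F" for h
      using that T(5) by fastforce
    show "h1 \<otimes>\<^bsub>ring_of_type_algebra\<^esub> h2 \<in> ?F" if h: "h1 \<in> ?F" "h2 \<in> ?F" for h1 h2
    proof -
      from h obtain a b c d where "h1 = Fract a b" "h2 = Fract c d"
        "a \<in> T" "b \<in> T" "c \<in> T" "d \<in> T" "b \<noteq> 0" "d \<noteq> 0" by blast
      then have "h1 * h2 = Fract (a * c) (b * d)" "a * c \<in> T" "b * d \<in> T" "b * d \<noteq> 0"
        using T by auto
      then show ?thesis unfolding ring_of_type_algebra_sel by blast
    qed
    show "h1 \<oplus>\<^bsub>ring_of_type_algebra\<^esub> h2 \<in> ?F" if h: "h1 \<in> ?F" "h2 \<in> ?F" for h1 h2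
    proof -
      from h obtain a b c d where "h1 = Fract a b" "h2 = Fract c d"
        "a \<in> T" "b \<in> T" "c \<in> T" "d \<in> T" "b \<noteq> 0" "d \<noteq> 0" by blast
      then have "h1 + h2 = Fract (a * d + c * b) (b * d)" "a * d + c * b \<in> T" "b * d \<in> T" "b * d \<noteq> 0"
        using T by auto
      then show ?thesis unfolding ring_of_type_algebra_sel by blast
    qed
  qed auto
  have "subfield ?F ring_of_type_algebra"
  proof (rule F.subfieldI'[OF subcring.axioms(1)[OF sub]])
    fix k assume k: "k \<in> ?F - {\<zero>\<^bsub>ring_of_type_algebra\<^esub>}"
    then obtain a b where ab: "k = Fract a b" "a \<in> T" "b \<in> T" "b \<noteq> 0" by blast
    with k have a: "a \<noteq> 0" by (auto simp: fract_collapse)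
    have "inv\<^bsub>ring_of_type_algebra\<^esub> k = inverse k"
      by (rule F.comm_inv_char) (use k in auto)
    also have "\<dots> = Fract b a" by (simp add: ab)
    finally show "inv\<^bsub>ring_of_type_algebra\<^esub> k \<in> ?F" using ab a by blast
  qed
  then show ?thesis
    unfolding fraction_field_def by (intro F.subfield_iff(2))
qed

lemma domain_reciprocal_complement:
  fixes T :: "'a::idom set"
  assumes "subring T ring_of_type_algebra"
  shows "domain (reciprocal_complement T)"
proof -
  interpret F: field "fraction_field T" using assms by (rule field_fraction_field)
  have "{Fract 1 f |f. f \<in> T \<and> f \<noteq> 0} \<subseteq> carrier (fraction_field T)"
    using subringE(3)[OF assms] by (auto simp: fraction_field_def)
  then have "subring (generate_ring (fraction_field T) {Fract 1 f |f. f \<in> T \<and> f \<noteq> 0}) (fraction_field T)"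
    by (rule F.generate_ring_is_subring)
  then show ?thesis
    unfolding reciprocal_complement_def by (rule F.subring_is_domain)
qed

end

theory Submission
  imports Defs
begin

text \<open>Write \<open>T = K[X\<^sub>1,\<dots>,X\<^sub>n]\<close> and \<open>R = R(T)\<close>. A product of reciprocals is a reciprocal, so the elements
  of \<open>R\<close> are the finite sums of reciprocals \<open>1/f\<close>, and \<open>R\<close> can be studied through the degrees of
  these \<open>f\<close>.

  Let \<open>\<delta>\<close> be a degree function on \<open>T\<close>: additive on products, and on sums at most the maximum. It extends
  to fractions by \<open>\<delta>(f/g) = \<delta> f - \<delta> g\<close>. All of \<open>R\<close> has degree at most \<open>0\<close>, hence the elements of
  negative degree form a prime ideal of \<open>R\<close>, the centre of \<open>\<delta>\<close> (\<open>primeideal_centre\<close>); it contains \<open>1/f\<close>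
  exactly if \<open>\<delta> f > 0\<close>. If \<open>\<delta> f = 0\<close> implies \<open>\<epsilon> f = 0\<close>, then the centre of \<open>\<epsilon>\<close> lies in the centre of
  \<open>\<delta>\<close> (\<open>centre_antimono\<close>). Let \<open>Q\<^sub>s\<close> be the centre of the degree in the variables with index greater
  than \<open>s\<close>. Then \<open>0 \<subset> Q\<^bsub>n-1\<^esub> \<subset> \<dots> \<subset> Q\<^sub>0\<close>, where the inclusions are strict because \<open>1/X\<^sub>j\<close> lies in \<open>Q\<^sub>s\<close>
  exactly if \<open>s < j\<close>.

  This chain of primes has length \<open>n\<close>, and no chain is longer (\<open>prime_chain_length_le\<close>): choosing from
  each prime an element outside its predecessor gives algebraically independent elements
  (\<open>prime_chain_independent\<close>), of which the field of fractions of \<open>T\<close> has at most \<open>n\<close>, by counting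
  monomials. A chain of primes of maximal length determines the height of its members
  (\<open>ideal_height_in_longest_chain\<close>), so \<open>Q\<^sub>s\<close> has height \<open>n - s\<close>.

  For \<open>1 \<le> s < n\<close>, infinitely many primes of this kind come from changes of coordinates. For \<open>k \<ge> 1\<close>
  use \<open>X\<^sub>1 + X\<^sub>n\<^sup>k, X\<^sub>2, \<dots>, X\<^sub>n\<close> in place of \<open>X\<^sub>1, \<dots>, X\<^sub>n\<close>. The resulting prime does not contain the
  reciprocal of its own coordinate \<open>X\<^sub>1 + X\<^sub>n\<^sup>k\<close>, but it contains that of \<open>X\<^sub>1 + X\<^sub>n\<^sup>l\<close> for every positive
  \<open>l \<noteq> k\<close>, so distinct \<open>k\<close> give distinct primes (\<open>inj_on_twisted_prime\<close>).\<close>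

section \<open>Prime ideals of subrings of a commutative ring type\<close>

abbreviation subring_record :: "'a::comm_ring_1 set \<Rightarrow> 'a ring"
  where "subring_record S \<equiv> ring_of_type_algebra\<lparr>carrier := S\<rparr>"

lemma cring_subring_record:
  assumes "subring S (ring_of_type_algebra :: 'a::comm_ring_1 ring)"
  shows "cring (subring_record S)"
proof -
  interpret cring "ring_of_type_algebra :: 'a ring" by (rule cring_from_type_algebra)
  show ?thesis
    using subcring_iff[of S] subcringI'[OF assms] by simp
qed

lemma a_inv_subring_record:
  fixes S :: "'a::comm_ring_1 set"
  assumes "subring S ring_of_type_algebra" "x \<in> S"
  shows "\<ominus>\<^bsub>subring_record S\<^esub> x = - x"
proof -
  interpret cring "subring_record S" by (rule cring_subring_record[OF assms(1)])
  show ?thesis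
    by (rule minus_equality) (use assms subringE(5)[OF assms(1)] in auto)
qed

text \<open>Inside a commutative ring type, ideals of a subring are sets of elements of the type. This
  turns primality into conditions on the operations of the type, with which all later arguments
  compute.\<close>

lemma primeideal_subring_record_iff:
  fixes S P :: "'a::comm_ring_1 set"
  assumes S: "subring S ring_of_type_algebra"
  shows "primeideal P (subring_record S) \<longleftrightarrow>
    P \<subseteq> S \<and> 0 \<in> P \<and> 1 \<notin> P \<and> (\<forall>x\<in>P. \<forall>y\<in>P. x + y \<in> P) \<and> (\<forall>x\<in>S. \<forall>y\<in>P. x * y \<in> P) \<and>
    (\<forall>x\<in>S. \<forall>y\<in>S. x * y \<in> P \<longrightarrow> x \<in> P \<or> y \<in> P)" (is "_ \<longleftrightarrow> ?rhs")
proof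
  assume "primeideal P (subring_record S)"
  then interpret primeideal P "subring_record S" .
  show ?rhs
  proof (intro conjI ballI impI)
    show "1 \<notin> P" using one_imp_carrier I_notcarr by auto
    show "P \<subseteq> S" using a_subset by simp
    show "0 \<in> P" using additive_subgroup.zero_closed[OF additive_subgroup_axioms] by simp
    show "x + y \<in> P" if "x \<in> P" "y \<in> P" for x y
      using additive_subgroup.a_closed[OF additive_subgroup_axioms that] by simp
    show "x * y \<in> P" if "x \<in> S" "y \<in> P" for x y
      using I_l_closed[of y x] that by simp
    show "x \<in> P \<or> y \<in> P" if "x \<in> S" "y \<in> S" "x * y \<in> P" for x y
      using I_prime[of x y] that by simp
  qed
next
  assume ?rhs
  then have rhs: "P \<subseteq> S" "0 \<in> P" "1 \<notin> P" and add: "\<And>x y. x \<in> P \<Longrightarrow> y \<in> P \<Longrightarrow> x + y \<in> P"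
    and mult: "\<And>x y. x \<in> S \<Longrightarrow> y \<in> P \<Longrightarrow> x * y \<in> P"
    and prime: "\<And>x y. x \<in> S \<Longrightarrow> y \<in> S \<Longrightarrow> x * y \<in> P \<Longrightarrow> x \<in> P \<or> y \<in> P"
    by auto
  note E = subringE[OF S, simplified]
  interpret cring "subring_record S" by (rule cring_subring_record[OF S])
  have neg: "\<ominus>\<^bsub>subring_record S\<^esub> x \<in> P" if "x \<in> P" for x
    using mult[OF E(5)[OF E(3)] that] a_inv_subring_record[OF S] rhs(1) that by auto
  have sub: "subgroup P (add_monoid (subring_record S))"
  proof (rule add.subgroupI)
    show "P \<subseteq> carrier (subring_record S)" "P \<noteq> {}" using rhs by auto
    show "x \<oplus>\<^bsub>subring_record S\<^esub> y \<in> P" if "x \<in> P" "y \<in> P" for x y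
      using add[OF that] by simp
  qed (rule neg)
  show "primeideal P (subring_record S)"
  proof (rule primeidealI)
    show "ideal P (subring_record S)"
    proof (rule idealI[OF ring_axioms sub])
      fix a x assume "a \<in> P" "x \<in> carrier (subring_record S)"
      then show "x \<otimes>\<^bsub>subring_record S\<^esub> a \<in> P" "a \<otimes>\<^bsub>subring_record S\<^esub> x \<in> P"
        using mult[of x a] by (simp_all add: mult.commute)
    qed
    show "cring (subring_record S)" by (rule cring_axioms)
    show "carrier (subring_record S) \<noteq> P" using rhs(3) E(3) by auto
    show "x \<in> P \<or> y \<in> P" if "x \<in> carrier (subring_record S)" "y \<in> carrier (subring_record S)"
      "x \<otimes>\<^bsub>subring_record S\<^esub> y \<in> P" for x y
      using prime[of x y] that by simp
  qed
qed

section \<open>Sums of reciprocals\<close>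

inductive_set reciprocal_sums :: "'a::idom set \<Rightarrow> 'a fract set" for T where
  zero: "0 \<in> reciprocal_sums T"
| step: "x \<in> reciprocal_sums T \<Longrightarrow> f \<in> T \<Longrightarrow> f \<noteq> 0 \<Longrightarrow> Fract 1 f + x \<in> reciprocal_sums T"

lemma reciprocal_sums_add:
  assumes "x \<in> reciprocal_sums T" "y \<in> reciprocal_sums T"
  shows "x + y \<in> reciprocal_sums T"
  using assms(1)
proof induct
  case (step x f)
  then show ?case using reciprocal_sums.step[of "x + y" T f] by (simp add: add.assoc)
qed (use assms in simp)

lemma reciprocal_in_sums: "f \<in> T \<Longrightarrow> f \<noteq> 0 \<Longrightarrow> Fract 1 f \<in> reciprocal_sums T"
  using reciprocal_sums.step[OF reciprocal_sums.zero, of f] by simp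

text \<open>The sums of reciprocals are closed under products because \<open>1/f \<cdot> 1/g = 1/(f g)\<close>.\<close>

lemma subring_reciprocal_sums:
  fixes T :: "'a::idom set"
  assumes "subring T ring_of_type_algebra"
  shows "subring (reciprocal_sums T) ring_of_type_algebra"
proof -
  note T = subringE[OF assms, simplified]
  interpret F: cring "ring_of_type_algebra :: 'a fract ring" by (rule cring_from_type_algebra)
  have recip_mult: "Fract 1 f * y \<in> reciprocal_sums T"
    if "y \<in> reciprocal_sums T" and f: "f \<in> T" "f \<noteq> 0" for f y
    using that(1)
  proof induct
    case (step x g)
    then show ?case
      using reciprocal_sums.step[of "Fract 1 f * x" T "f * g"] f T(6) by (simp add: ring_distribs)
  qed (simp add: reciprocal_sums.zero)
  show ?thesis
  proof (rule F.subringI)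
    show "\<one>\<^bsub>ring_of_type_algebra\<^esub> \<in> reciprocal_sums T"
      using reciprocal_in_sums[of 1 T] T(3) by (simp add: One_fract_def)
    fix x y assume x: "x \<in> reciprocal_sums T" and y: "y \<in> reciprocal_sums T"
    show "x \<oplus>\<^bsub>ring_of_type_algebra\<^esub> y \<in> reciprocal_sums T"
      using reciprocal_sums_add[OF x y] by simp
    show "x \<otimes>\<^bsub>ring_of_type_algebra\<^esub> y \<in> reciprocal_sums T"
      unfolding ring_of_type_algebra_sel using x
    proof induct
      case (step x f)
      then show ?case
        using reciprocal_sums_add[OF recip_mult[OF y]] by (simp add: ring_distribs)
    qed (simp add: reciprocal_sums.zero)
  next
    fix x assume "x \<in> reciprocal_sums T"
    then show "\<ominus>\<^bsub>ring_of_type_algebra\<^esub> x \<in> reciprocal_sums T"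
      unfolding a_inv_ring_of_type_algebra
    proof induct
      case (step x f)
      have "Fract 1 (- f) = - Fract 1 f"
        using minus_fract_cancel[of "-1" f] by simp
      then show ?case
        using reciprocal_sums.step[of "- x" T "- f"] step T(5) by simp
    qed (simp add: reciprocal_sums.zero)
  qed auto
qed

lemma reciprocal_complement_eq:
  fixes T :: "'a::idom set"
  assumes "subring T ring_of_type_algebra"
  shows "reciprocal_complement T = subring_record (reciprocal_sums T)"
proof -
  let ?F = "fraction_field T"
  let ?H = "{Fract 1 f |f. f \<in> T \<and> f \<noteq> 0}"
  note T = subringE[OF assms, simplified]
  interpret F: field ?F using assms by (rule field_fraction_field)
  interpret A: field "ring_of_type_algebra :: 'a fract ring" by (rule field_from_type_algebra)
  note S = subringE[OF subring_reciprocal_sums[OF assms], simplified]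
  have H: "?H \<subseteq> carrier ?F" using T(3) by (auto simp: fraction_field_def)
  have "generate_ring ?F ?H = reciprocal_sums T"
  proof
    have inv: "\<ominus>\<^bsub>?F\<^esub> x = - x" if "x \<in> carrier ?F" for x
    proof -
      have "- x \<in> carrier ?F" using that T(5) by (fastforce simp: fraction_field_def)
      with that show ?thesis by (intro F.minus_equality) (auto simp: fraction_field_def)
    qed
    show "generate_ring ?F ?H \<subseteq> reciprocal_sums T"
    proof
      fix x assume "x \<in> generate_ring ?F ?H"
      then show "x \<in> reciprocal_sums T"
      proof induct
        case (a_inv h)
        then show ?case using F.generate_ring_in_carrier[OF H] inv S(5) by simp
      qed (use S reciprocal_in_sums[of _ T] in \<open>auto simp: fraction_field_def\<close>)
    qed
    show "reciprocal_sums T \<subseteq> generate_ring ?F ?H"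
    proof
      fix x assume "x \<in> reciprocal_sums T"
      then show "x \<in> generate_ring ?F ?H"
      proof induct
        case zero
        show ?case using F.zero_in_generate[of ?H] by (simp add: fraction_field_def)
      next
        case (step x f)
        then have "Fract 1 f \<in> generate_ring ?F ?H" by (intro generate_ring.incl) blast
        then have "Fract 1 f \<oplus>\<^bsub>?F\<^esub> x \<in> generate_ring ?F ?H"
          using step(2) by (rule generate_ring.eng_add)
        then show ?case by (simp add: fraction_field_def)
      qed
    qed
  qed
  then show ?thesis unfolding reciprocal_complement_def fraction_field_def by simp
qed

section \<open>Prime ideals from degree functions\<close>

locale degree_function =
  fixes \<delta> :: "'a::idom \<Rightarrow> nat"
  assumes zero [simp]: "\<delta> 0 = 0"
    and mult: "f \<noteq> 0 \<Longrightarrow> g \<noteq> 0 \<Longrightarrow> \<delta> (f * g) = \<delta> f + \<delta> g"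
    and add_le: "\<delta> (f + g) \<le> max (\<delta> f) (\<delta> g)"
begin

lemma one [simp]: "\<delta> 1 = 0"
  using mult[of 1 1] by simp

text \<open>Fractions of degree at most \<open>0\<close>, and below \<open>0\<close>, when \<open>f/g\<close> gets the degree \<open>\<delta> f - \<delta> g\<close> and \<open>0\<close>
  the degree \<open>-\<infinity>\<close>: a valuation ring and its maximal ideal. They are described through representatives,
  since \<open>\<delta>\<close> is only given on \<open>'a\<close>; the lemmas \<open>Fract_nonpos_iff\<close> and \<open>Fract_negative_iff\<close> show that
  the choice of the representative does not matter.\<close>

definition nonpos :: "'a fract set"
  where "nonpos = {Fract f g |f g. g \<noteq> 0 \<and> (f = 0 \<or> \<delta> f \<le> \<delta> g)}"

definition negative :: "'a fract set"
  where "negative = {Fract f g |f g. g \<noteq> 0 \<and> (f = 0 \<or> \<delta> f < \<delta> g)}"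

lemma Fract_nonpos_iff:
  assumes "g \<noteq> 0"
  shows "Fract f g \<in> nonpos \<longleftrightarrow> f = 0 \<or> \<delta> f \<le> \<delta> g"
proof
  assume "Fract f g \<in> nonpos"
  then obtain a b where ab: "Fract f g = Fract a b" "b \<noteq> 0" "a = 0 \<or> \<delta> a \<le> \<delta> b"
    unfolding nonpos_def by blast
  then have eq: "f * b = a * g" using assms by (simp add: eq_fract)
  show "f = 0 \<or> \<delta> f \<le> \<delta> g"
  proof (cases "f = 0")
    case False
    then have "a \<noteq> 0" using eq ab(2) by auto
    then show ?thesis using mult[OF False ab(2)] mult[OF _ assms, of a] eq ab(3) by simp
  qed simp
qed (use assms in \<open>auto simp: nonpos_def\<close>)

lemma Fract_negative_iff:
  assumes "g \<noteq> 0"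
  shows "Fract f g \<in> negative \<longleftrightarrow> f = 0 \<or> \<delta> f < \<delta> g"
proof
  assume "Fract f g \<in> negative"
  then obtain a b where ab: "Fract f g = Fract a b" "b \<noteq> 0" "a = 0 \<or> \<delta> a < \<delta> b"
    unfolding negative_def by blast
  then have eq: "f * b = a * g" using assms by (simp add: eq_fract)
  show "f = 0 \<or> \<delta> f < \<delta> g"
  proof (cases "f = 0")
    case False
    then have "a \<noteq> 0" using eq ab(2) by auto
    then show ?thesis using mult[OF False ab(2)] mult[OF _ assms, of a] eq ab(3) by simp
  qed simp
qed (use assms in \<open>auto simp: negative_def\<close>)

lemma negative_add:
  assumes "x \<in> negative" "y \<in> negative"
  shows "x + y \<in> negative"
proof -
  obtain a b where x: "x = Fract a b" "b \<noteq> 0" "a = 0 \<or> \<delta> a < \<delta> b"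
    using assms(1) unfolding negative_def by blast
  obtain c d where y: "y = Fract c d" "d \<noteq> 0" "c = 0 \<or> \<delta> c < \<delta> d"
    using assms(2) unfolding negative_def by blast
  have "a * d + c * b = 0 \<or> \<delta> (a * d + c * b) < \<delta> (b * d)"
  proof (cases "a = 0 \<or> c = 0")
    case True
    then show ?thesis using x y by (cases "a = 0"; cases "c = 0") (auto simp: mult)
  next
    case False
    then show ?thesis using x y add_le[of "a * d" "c * b"] by (auto simp: mult)
  qed
  then show ?thesis using x y by (simp add: Fract_negative_iff)
qed

lemma nonpos_add:
  assumes "x \<in> nonpos" "y \<in> nonpos"
  shows "x + y \<in> nonpos"
proof -
  obtain a b where x: "x = Fract a b" "b \<noteq> 0" "a = 0 \<or> \<delta> a \<le> \<delta> b"
    using assms(1) unfolding nonpos_def by blast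
  obtain c d where y: "y = Fract c d" "d \<noteq> 0" "c = 0 \<or> \<delta> c \<le> \<delta> d"
    using assms(2) unfolding nonpos_def by blast
  have "a * d + c * b = 0 \<or> \<delta> (a * d + c * b) \<le> \<delta> (b * d)"
  proof (cases "a = 0 \<or> c = 0")
    case True
    then show ?thesis using x y by (cases "a = 0"; cases "c = 0") (auto simp: mult)
  next
    case False
    then show ?thesis using x y add_le[of "a * d" "c * b"] by (auto simp: mult)
  qed
  then show ?thesis using x y by (simp add: Fract_nonpos_iff)
qed

lemma nonpos_mult_negative:
  assumes "x \<in> nonpos" "y \<in> negative"
  shows "x * y \<in> negative"
proof -
  obtain a b where x: "x = Fract a b" "b \<noteq> 0" "a = 0 \<or> \<delta> a \<le> \<delta> b"
    using assms(1) unfolding nonpos_def by blast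
  obtain c d where y: "y = Fract c d" "d \<noteq> 0" "c = 0 \<or> \<delta> c < \<delta> d"
    using assms(2) unfolding negative_def by blast
  show ?thesis using x y mult[of a c] mult[of b d]
    by (cases "a = 0"; cases "c = 0") (auto simp: Fract_negative_iff)
qed

lemma negative_multD:
  assumes "x \<in> nonpos" "y \<in> nonpos" "x * y \<in> negative"
  shows "x \<in> negative \<or> y \<in> negative"
proof -
  obtain a b where x: "x = Fract a b" "b \<noteq> 0" "a = 0 \<or> \<delta> a \<le> \<delta> b"
    using assms(1) unfolding nonpos_def by blast
  obtain c d where y: "y = Fract c d" "d \<noteq> 0" "c = 0 \<or> \<delta> c \<le> \<delta> d"
    using assms(2) unfolding nonpos_def by blast
  show ?thesis using assms(3) x y mult[of a c] mult[of b d]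
    by (cases "a = 0"; cases "c = 0") (auto simp: Fract_negative_iff)
qed

lemma negative_uminus:
  assumes "x \<in> negative"
  shows "- x \<in> negative"
proof -
  have "(- 1 :: 'a fract) \<in> nonpos"
    using mult[of "- 1" "- 1"] by (simp add: One_fract_def Fract_nonpos_iff)
  then show ?thesis using nonpos_mult_negative[of "- 1" x] assms by simp
qed

lemma reciprocal_sums_nonpos: "reciprocal_sums T \<subseteq> nonpos"
proof
  fix x assume "x \<in> reciprocal_sums T"
  then show "x \<in> nonpos"
  proof induct
    case (step x f)
    then show ?case using nonpos_add[of "Fract 1 f" x] by (simp add: Fract_nonpos_iff)
  qed (simp add: Zero_fract_def Fract_nonpos_iff)
qed

text \<open>The contraction to the reciprocal complement of the maximal ideal of the valuation ring.\<close>

definition centre :: "'a set \<Rightarrow> 'a fract set"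
  where "centre T = reciprocal_sums T \<inter> negative"

lemma primeideal_centre:
  assumes "subring T ring_of_type_algebra"
  shows "primeideal (centre T) (reciprocal_complement T)"
proof -
  note S = subringE[OF subring_reciprocal_sums[OF assms], simplified]
  show ?thesis
    unfolding reciprocal_complement_eq[OF assms]
      primeideal_subring_record_iff[OF subring_reciprocal_sums[OF assms]]
  proof (intro conjI ballI impI)
    show "centre T \<subseteq> reciprocal_sums T" by (simp add: centre_def)
    show "0 \<in> centre T" using S(2) by (simp add: centre_def Zero_fract_def Fract_negative_iff)
    show "1 \<notin> centre T" by (simp add: centre_def One_fract_def Fract_negative_iff)
    show "x + y \<in> centre T" if "x \<in> centre T" "y \<in> centre T" for x y
      using that S(7) negative_add by (simp add: centre_def)
    show "x * y \<in> centre T" if "x \<in> reciprocal_sums T" "y \<in> centre T" for x y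
      using that S(6)[of x y] nonpos_mult_negative[of x y] reciprocal_sums_nonpos[of T]
      by (auto simp: centre_def)
    show "x \<in> centre T \<or> y \<in> centre T"
      if "x \<in> reciprocal_sums T" "y \<in> reciprocal_sums T" "x * y \<in> centre T" for x y
      using that negative_multD[of x y] reciprocal_sums_nonpos[of T] by (auto simp: centre_def)
  qed
qed

lemma reciprocal_in_centre_iff:
  assumes "f \<in> T" "f \<noteq> 0"
  shows "Fract 1 f \<in> centre T \<longleftrightarrow> \<delta> f > 0"
  using assms by (simp add: centre_def Fract_negative_iff reciprocal_in_sums)

end

text \<open>In a sum of reciprocals collect those \<open>1/f\<close> with \<open>\<epsilon> f = 0\<close>. They sum up to a fraction \<open>a/b\<close>
  with \<open>\<epsilon> a = \<epsilon> b = 0\<close>, whereas the rest has negative degree for \<open>\<epsilon>\<close>. So if the whole sum has negative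
  degree for \<open>\<epsilon>\<close>, then so has \<open>a/b\<close>, which forces \<open>a = 0\<close>. What remains are reciprocals \<open>1/f\<close> with
  \<open>\<epsilon> f > 0\<close>, for which also \<open>\<delta> f > 0\<close>.\<close>

lemma centre_antimono:
  fixes \<delta> \<epsilon> :: "'a::idom \<Rightarrow> nat"
  assumes "degree_function \<delta>" "degree_function \<epsilon>"
    and le: "\<And>f. f \<in> T \<Longrightarrow> \<delta> f = 0 \<Longrightarrow> \<epsilon> f = 0"
  shows "degree_function.centre \<epsilon> T \<subseteq> degree_function.centre \<delta> T"
proof
  interpret d: degree_function \<delta> by fact
  interpret e: degree_function \<epsilon> by fact
  have decomp: "\<exists>a b c. x = Fract a b + c \<and> b \<noteq> 0 \<and> \<epsilon> a = 0 \<and> \<epsilon> b = 0 \<and> c \<in> d.negative \<and> c \<in> e.negative"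
    if "x \<in> reciprocal_sums T" for x
    using that
  proof induct
    case zero
    show ?case
      by (intro exI[of _ 0] exI[of _ 1])
        (simp add: Zero_fract_def d.Fract_negative_iff e.Fract_negative_iff)
  next
    case (step x f)
    then obtain a b c where x: "x = Fract a b + c" "b \<noteq> 0" "\<epsilon> a = 0" "\<epsilon> b = 0"
      "c \<in> d.negative" "c \<in> e.negative" by blast
    show ?case
    proof (cases "\<epsilon> f = 0")
      case True
      have "Fract 1 f + x = Fract (b + a * f) (f * b) + c"
        using x step by (simp add: add.assoc)
      moreover have "\<epsilon> (a * f) = 0"
        using e.mult[of a f] x True step by (cases "a = 0") auto
      then have "\<epsilon> (b + a * f) = 0" using e.add_le[of b "a * f"] x by simp
      moreover have "f * b \<noteq> 0" "\<epsilon> (f * b) = 0" using x step True e.mult[of f b] by auto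
      ultimately show ?thesis using x by blast
    next
      case False
      then have "Fract 1 f \<in> d.negative" "Fract 1 f \<in> e.negative"
        using step(3,4) le[of f] by (auto simp: d.Fract_negative_iff e.Fract_negative_iff)
      then have "Fract 1 f + c \<in> d.negative" "Fract 1 f + c \<in> e.negative"
        using x d.negative_add e.negative_add by auto
      moreover have "Fract 1 f + x = Fract a b + (Fract 1 f + c)" using x by simp
      ultimately show ?thesis using x by blast
    qed
  qed
  fix x assume x: "x \<in> e.centre T"
  then obtain a b c where abc: "x = Fract a b + c" "b \<noteq> 0" "\<epsilon> a = 0" "\<epsilon> b = 0"
      "c \<in> d.negative" "c \<in> e.negative" using decomp unfolding e.centre_def by blast
  have "Fract a b = x + - c" using abc by simp
  also have "\<dots> \<in> e.negative"
    using e.negative_add[OF _ e.negative_uminus] x abc unfolding e.centre_def by blast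
  finally have "a = 0" using abc by (simp add: e.Fract_negative_iff)
  then have "x = c" using abc by (simp add: fract_collapse)
  then show "x \<in> d.centre T" using x abc unfolding e.centre_def d.centre_def by simp
qed

section \<open>Independence along chains of primes\<close>

definition power_product :: "'a::comm_monoid_mult list \<Rightarrow> nat list \<Rightarrow> 'a"
  where "power_product xs es = prod_list (map2 (^) xs es)"

lemma power_product_simps [simp]:
  "power_product [] es = 1"
  "power_product (x # xs) (e # es) = x ^ e * power_product xs es"
  by (simp_all add: power_product_def)

text \<open>Elements \<open>x\<^sub>1, \<dots>, x\<^sub>k\<close> with \<open>x\<^sub>j \<in> C\<^sub>j - C\<^bsub>j-1\<^esub>\<close> satisfy no polynomial relation with coefficients
  outside \<open>C\<^sub>k\<close>. In a relation modulo \<open>C\<^sub>0\<close> take the least exponent \<open>m\<close> of \<open>x\<^sub>1\<close>. As \<open>x\<^sub>1 \<notin> C\<^sub>0\<close>, the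
  factor \<open>x\<^sub>1\<^sup>m\<close> can be cancelled modulo the prime \<open>C\<^sub>0\<close>; as \<open>x\<^sub>1 \<in> C\<^sub>1\<close>, the terms still
  divisible by \<open>x\<^sub>1\<close> then vanish modulo \<open>C\<^sub>1\<close>. The terms with exponent \<open>m\<close> thus give a relation of
  \<open>x\<^sub>2, \<dots>, x\<^sub>k\<close> modulo \<open>C\<^sub>1\<close>, and the induction goes on with the chain \<open>C\<^sub>1, \<dots>, C\<^sub>k\<close>. The relation is
  assumed modulo \<open>C 0\<close>, not as an equation, for the sake of this induction.\<close>

lemma prime_chain_independent:
  fixes C :: "nat \<Rightarrow> 'a::comm_ring_1 set" and u :: "nat list \<Rightarrow> 'a"
  assumes S: "subring S ring_of_type_algebra"
    and prime: "\<And>j. j \<le> length xs \<Longrightarrow> primeideal (C j) (subring_record S)"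
    and chain: "\<And>j. j < length xs \<Longrightarrow> C j \<subseteq> C (Suc j)"
    and xs: "\<And>j. j < length xs \<Longrightarrow> xs ! j \<in> C (Suc j) - C j"
    and E: "finite E" "\<And>e. e \<in> E \<Longrightarrow> length e = length xs"
    and u: "\<And>e. e \<in> E \<Longrightarrow> u e \<in> S - C (length xs)"
    and rel: "(\<Sum>e\<in>E. u e * power_product xs e) \<in> C 0"
  shows "E = {}"
  using assms(2-)
proof (induction xs arbitrary: C E u)
  case Nil
  show ?case
  proof (rule ccontr)
    assume "E \<noteq> {}"
    then have "E = {[]}" using Nil(5) by auto
    then show False using Nil(6)[of "[]"] Nil(7) by simp
  qed
next
  case (Cons x xs)
  note primes = Cons.prems(1)[unfolded primeideal_subring_record_iff[OF S]]
  note SE = subringE[OF S, simplified]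
  have C0: "C 0 \<subseteq> S" "\<And>a b. a \<in> S \<Longrightarrow> b \<in> S \<Longrightarrow> a * b \<in> C 0 \<Longrightarrow> a \<in> C 0 \<or> b \<in> C 0"
    using primes[of 0] by auto
  have C1: "C (Suc 0) \<subseteq> S" "0 \<in> C (Suc 0)" "\<And>a b. a \<in> C (Suc 0) \<Longrightarrow> b \<in> C (Suc 0) \<Longrightarrow> a + b \<in> C (Suc 0)"
    "\<And>a b. a \<in> S \<Longrightarrow> b \<in> C (Suc 0) \<Longrightarrow> a * b \<in> C (Suc 0)"
    using primes[of "Suc 0"] by auto
  have x: "x \<in> C (Suc 0)" "x \<notin> C 0" using Cons.prems(3)[of 0] by auto
  have power_S: "a ^ k \<in> S" if "a \<in> S" for a k
    using that SE(3,6) by (induction k) auto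
  have power_C0: "x ^ k \<notin> C 0" for k
  proof (induction k)
    case 0
    then show ?case using primes[of 0] by simp
  next
    case (Suc k)
    then show ?case using C0(2)[of x "x ^ k"] x C1(1) power_S by auto
  qed
  have xs_S: "set xs \<subseteq> S"
  proof
    fix y assume "y \<in> set xs"
    then obtain j where j: "j < length xs" "y = xs ! j" by (auto simp: in_set_conv_nth)
    then have "y \<in> C (Suc (Suc j))" using Cons.prems(3)[of "Suc j"] by simp
    then show "y \<in> S" using primes[of "Suc (Suc j)"] j by auto
  qed
  have pp_S: "power_product ys e \<in> S" if "set ys \<subseteq> S" "length e = length ys" for ys e
    using that(2,1) by (induction e ys rule: list_induct2) (auto intro: SE(3,6) power_S)
  have sum_S: "sum f A \<in> S" if "\<And>a. a \<in> A \<Longrightarrow> f a \<in> S" for f :: "nat list \<Rightarrow> 'a" and A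
    using that by (induction A rule: infinite_finite_induct) (auto intro: SE(2,7))
  have sum_C1: "sum f A \<in> C (Suc 0)" if "\<And>a. a \<in> A \<Longrightarrow> f a \<in> C (Suc 0)" for f :: "nat list \<Rightarrow> 'a" and A
    using that by (induction A rule: infinite_finite_induct) (auto intro: C1(2,3))
  show ?case
  proof (rule ccontr)
    assume "E \<noteq> {}"
    define m where "m = Min (hd ` E)"
    \<comment> \<open>the term of \<open>e\<close> after cancellation of the common factor \<open>x ^ m\<close>\<close>
    define g where "g e = u e * x ^ (hd e - m) * power_product xs (tl e)" for e
    have uS: "u e \<in> S" if "e \<in> E" for e using Cons.prems(6)[OF that] by blast
    have len: "length (tl e) = length xs" if "e \<in> E" for e using Cons.prems(5)[OF that] by simp
    have m_le: "m \<le> hd e" if "e \<in> E" for e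
      using that Cons.prems(4) unfolding m_def by simp
    have gS: "g e \<in> S" if "e \<in> E" for e
      unfolding g_def by (intro SE(6) uS that power_S pp_S xs_S len) (use x C1 in auto)
    have "u e * power_product (x # xs) e = x ^ m * g e" if eE: "e \<in> E" for e
    proof -
      obtain a e' where e: "e = a # e'" using Cons.prems(5)[OF eE] by (cases e) auto
      have "x ^ a = x ^ m * x ^ (a - m)" using m_le[OF eE] e by (simp flip: power_add)
      then show ?thesis by (simp add: e g_def mult_ac)
    qed
    then have "x ^ m * sum g E \<in> C 0"
      using Cons.prems(7) by (simp add: sum_distrib_left)
    then have "sum g E \<in> C 0"
      using C0(2)[of "x ^ m" "sum g E"] power_C0 power_S x C1(1) sum_S[of E g] gS by blast
    then have g1: "sum g E \<in> C (Suc 0)" using Cons.prems(2)[of 0] by auto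
    define E0 where "E0 = {e \<in> E. hd e = m}"
    have "g e \<in> C (Suc 0)" if "e \<in> E - E0" for e
    proof -
      have "hd e - m \<noteq> 0" using that m_le[of e] unfolding E0_def by auto
      then obtain k where k: "hd e - m = Suc k" using not0_implies_Suc by blast
      have "g e = (u e * x ^ k * power_product xs (tl e)) * x"
        by (simp add: g_def k mult_ac)
      moreover have "u e * x ^ k * power_product xs (tl e) \<in> S"
        using that x C1(1) by (intro SE(6) uS power_S pp_S xs_S len) auto
      ultimately show ?thesis using C1(4) x by simp
    qed
    then have rest: "sum g (E - E0) \<in> C (Suc 0)" by (rule sum_C1)
    have "- 1 * sum g (E - E0) \<in> C (Suc 0)" using C1(4)[OF _ rest] SE(3,5) by blast
    then have "sum g E + - 1 * sum g (E - E0) \<in> C (Suc 0)" using C1(3)[OF g1] by blast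
    moreover have "sum g E = sum g (E - E0) + sum g E0"
      by (rule sum.subset_diff) (use Cons.prems(4) in \<open>auto simp: E0_def\<close>)
    ultimately have "sum g E0 \<in> C (Suc 0)" by simp
    moreover have cons: "e = m # tl e" if "e \<in> E0" for e
      using that Cons.prems(5)[of e] by (cases e) (auto simp: E0_def)
    then have inj: "inj_on tl E0" by (metis inj_onI)
    have "sum g E0 = (\<Sum>e\<in>tl ` E0. u (m # e) * power_product xs e)"
      unfolding sum.reindex[OF inj] o_def
    proof (rule sum.cong[OF refl])
      fix e assume "e \<in> E0"
      then have "hd e = m" "m # tl e = e" using cons[of e] by (auto simp: E0_def)
      then show "g e = u (m # tl e) * power_product xs (tl e)" by (simp add: g_def)
    qed
    ultimately have "(\<Sum>e\<in>tl ` E0. u (m # e) * power_product xs e) \<in> C (Suc 0)" by simp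
    then have "tl ` E0 = {}"
    proof (intro Cons.IH[of "\<lambda>j. C (Suc j)" "tl ` E0" "\<lambda>e. u (m # e)"])
      fix e assume "e \<in> tl ` E0"
      then have "m # e \<in> E" using cons by (force simp: E0_def)
      then show "length e = length xs" "u (m # e) \<in> S - C (Suc (length xs))"
        using Cons.prems(5,6)[of "m # e"] by auto
    next
      fix j assume "j < length xs"
      then show "xs ! j \<in> C (Suc (Suc j)) - C (Suc j)"
        using Cons.prems(3)[of "Suc j"] by simp
    qed (use Cons.prems(1,2,4) in \<open>auto simp: E0_def\<close>)
    moreover have "m \<in> hd ` E" unfolding m_def using \<open>E \<noteq> {}\<close> Cons.prems(4) by (intro Min_in) auto
    then have "E0 \<noteq> {}" unfolding E0_def by blast
    ultimately show False by simp
  qed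
qed

section \<open>The length of chains of primes\<close>

text \<open>Stated for families, not sets, because two distinct monomials in the elements of a chain
  might coincide as elements; such a coincidence is itself a dependence.\<close>

lemma (in vector_space) family_dependent:
  assumes "finite I" "finite B" "z ` I \<subseteq> span B" "card B < card I"
  shows "\<exists>c. (\<exists>i\<in>I. c i \<noteq> 0) \<and> (\<Sum>i\<in>I. scale (c i) (z i)) = 0"
proof (cases "inj_on z I")
  case True
  then have "card (z ` I) = card I" by (rule card_image)
  then have "dependent (z ` I)" using independent_span_bound[of B "z ` I"] assms by auto
  then obtain c where c: "\<exists>v\<in>z ` I. c v \<noteq> 0" "(\<Sum>v\<in>z ` I. scale (c v) v) = 0"
    using assms(1) by (subst (asm) dependent_finite) auto
  then show ?thesis
    using sum.reindex[OF True, of "\<lambda>v. scale (c v) v"]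
    by (intro exI[of _ "c \<circ> z"]) (auto simp: o_def)
next
  case False
  then obtain i j where ij: "i \<in> I" "j \<in> I" "i \<noteq> j" "z i = z j" by (auto simp: inj_on_def)
  define c where "c k = (if k = i then 1 else if k = j then - 1 else (0::'a))" for k
  have "(\<Sum>k\<in>I. scale (c k) (z k)) = (\<Sum>k\<in>{i, j}. scale (c k) (z k))"
    by (rule sum.mono_neutral_right) (use assms ij in \<open>auto simp: c_def\<close>)
  also have "\<dots> = 0" using ij by (simp add: c_def)
  finally show ?thesis using ij(1) by (intro exI[of _ c]) (auto simp: c_def)
qed

text \<open>The bound is on the exponent of each single variable, not on the total degree, so that the
  count of monomials is a plain power.\<close>

definition bounded_polynomials :: "nat \<Rightarrow> nat \<Rightarrow> ((nat \<Rightarrow>\<^sub>0 nat) \<Rightarrow>\<^sub>0 'k::comm_ring_1) set"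
  where "bounded_polynomials n b = {p \<in> polynomials_in n.
    \<forall>m \<in> Poly_Mapping.keys p. \<forall>j. Poly_Mapping.lookup m j \<le> b}"

lemma bounded_polynomials_mult:
  assumes "p \<in> bounded_polynomials n b" "q \<in> bounded_polynomials n c"
  shows "p * q \<in> bounded_polynomials n (b + c)"
proof -
  have "p * q \<in> polynomials_in n"
    using subringE(6)[OF subring_polynomials_in, of p n q] assms
    by (simp add: bounded_polynomials_def)
  moreover have "Poly_Mapping.lookup m j \<le> b + c" if m': "m \<in> Poly_Mapping.keys (p * q)" for m j
  proof -
    obtain r s where m: "m = r + s" and rs: "r \<in> Poly_Mapping.keys p" "s \<in> Poly_Mapping.keys q"
      using keys_mult[of p q] m' by blast
    have "Poly_Mapping.lookup r j \<le> b" "Poly_Mapping.lookup s j \<le> c"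
      using rs assms unfolding bounded_polynomials_def by auto
    then show ?thesis unfolding m lookup_add by simp
  qed
  ultimately show ?thesis by (simp add: bounded_polynomials_def)
qed

lemma one_bounded_polynomials: "1 \<in> bounded_polynomials n b"
  using subringE(3)[OF subring_polynomials_in, of n]
  by (simp add: bounded_polynomials_def)

lemma bounded_polynomials_power:
  assumes "p \<in> bounded_polynomials n b"
  shows "p ^ k \<in> bounded_polynomials n (k * b)"
proof (induction k)
  case (Suc k)
  then show ?case using bounded_polynomials_mult[OF assms Suc] by simp
qed (simp add: one_bounded_polynomials)

lemma bounded_polynomials_mono:
  "b \<le> c \<Longrightarrow> bounded_polynomials n b \<subseteq> bounded_polynomials n c"
  unfolding bounded_polynomials_def by (auto intro: order_trans)

lemma polynomials_in_bounded:
  assumes "p \<in> polynomials_in n"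
  obtains b where "p \<in> bounded_polynomials n b"
proof
  define b where "b = Max (insert 0 (\<Union>m\<in>Poly_Mapping.keys p. Poly_Mapping.lookup m ` {1..n}))"
  have "Poly_Mapping.lookup m j \<le> b" if m: "m \<in> Poly_Mapping.keys p" for m j
  proof (cases "j \<in> {1..n}")
    case True
    then show ?thesis unfolding b_def by (intro Max_ge insertI2 UN_I[OF m] imageI) auto
  next
    case False
    then have "j \<notin> Poly_Mapping.keys m" using assms m unfolding polynomials_in_def by blast
    then show ?thesis by (simp add: in_keys_iff)
  qed
  then show "p \<in> bounded_polynomials n b" using assms by (simp add: bounded_polynomials_def)
qed

definition bounded_monomials :: "nat \<Rightarrow> nat \<Rightarrow> (nat \<Rightarrow>\<^sub>0 nat) set"
  where "bounded_monomials n b =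
    {m. Poly_Mapping.keys m \<subseteq> {1..n} \<and> (\<forall>j. Poly_Mapping.lookup m j \<le> b)}"

lemma card_bounded_monomials:
  "finite (bounded_monomials n b) \<and> card (bounded_monomials n b) \<le> Suc b ^ n"
proof -
  define L where "L = {es. set es \<subseteq> {..b} \<and> length es = n}"
  have L: "finite L" "card L = Suc b ^ n"
    unfolding L_def by (simp_all add: finite_lists_length_eq card_lists_length_eq)
  define h where "h m = map (Poly_Mapping.lookup m) [1..<Suc n]" for m :: "nat \<Rightarrow>\<^sub>0 nat"
  have inj: "inj_on h (bounded_monomials n b)"
  proof (rule inj_onI, rule poly_mapping_eqI)
    fix m m' j assume m: "m \<in> bounded_monomials n b" "m' \<in> bounded_monomials n b" "h m = h m'"
    show "Poly_Mapping.lookup m j = Poly_Mapping.lookup m' j"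
    proof (cases "j \<in> {1..n}")
      case True
      then show ?thesis using m(3) unfolding h_def by (simp add: map_eq_conv del: upt_Suc)
    next
      case False
      then have "j \<notin> Poly_Mapping.keys m" "j \<notin> Poly_Mapping.keys m'"
        using m unfolding bounded_monomials_def by auto
      then show ?thesis by (simp add: in_keys_iff)
    qed
  qed
  have "h ` bounded_monomials n b \<subseteq> L"
    unfolding L_def h_def bounded_monomials_def by auto
  then show ?thesis
    using L card_inj_on_le[OF inj] inj_on_finite[OF inj] by metis
qed

lemma poly_mapping_sum_singles:
  "(\<Sum>m\<in>Poly_Mapping.keys p. Poly_Mapping.single m (Poly_Mapping.lookup p m)) = p"
proof (rule poly_mapping_eqI)
  fix k
  show "Poly_Mapping.lookup (\<Sum>m\<in>Poly_Mapping.keys p. Poly_Mapping.single m (Poly_Mapping.lookup p m)) k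
    = Poly_Mapping.lookup p k"
    by (auto simp: lookup_sum lookup_single when_def in_keys_iff sum.delta)
qed

lemma vector_space_constants:
  "vector_space (\<lambda>(c::'k::field) (p::(nat \<Rightarrow>\<^sub>0 nat) \<Rightarrow>\<^sub>0 'k). Poly_Mapping.single 0 c * p)"
  by unfold_locales (simp_all add: ring_distribs single_add mult_single flip: mult.assoc)

lemma bounded_polynomials_dependent:
  fixes z :: "'i \<Rightarrow> (nat \<Rightarrow>\<^sub>0 nat) \<Rightarrow>\<^sub>0 'k::field"
  assumes "finite I" "z ` I \<subseteq> bounded_polynomials n b" "Suc b ^ n < card I"
  shows "\<exists>c. (\<exists>i\<in>I. c i \<noteq> 0) \<and> (\<Sum>i\<in>I. Poly_Mapping.single 0 (c i) * z i) = 0"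
proof -
  interpret vector_space "\<lambda>(c::'k) (p::(nat \<Rightarrow>\<^sub>0 nat) \<Rightarrow>\<^sub>0 'k). Poly_Mapping.single 0 c * p"
    by (rule vector_space_constants)
  let ?x = "\<lambda>m. Poly_Mapping.single m (1::'k)"
  let ?B = "?x ` bounded_monomials n b"
  note fin = card_bounded_monomials[of n b]
  have "p \<in> span ?B" if p: "p \<in> bounded_polynomials n b" for p
  proof -
    have "Poly_Mapping.single m (Poly_Mapping.lookup p m) \<in> span ?B"
      if m: "m \<in> Poly_Mapping.keys p" for m
    proof -
      have "m \<in> bounded_monomials n b"
        using m p unfolding bounded_polynomials_def polynomials_in_def bounded_monomials_def by blast
      then have "Poly_Mapping.single 0 (Poly_Mapping.lookup p m) * ?x m \<in> span ?B"
        by (intro span_scale span_base) auto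
      then show ?thesis by (simp add: mult_single)
    qed
    then have "(\<Sum>m\<in>Poly_Mapping.keys p. Poly_Mapping.single m (Poly_Mapping.lookup p m)) \<in> span ?B"
      by (rule span_sum)
    then show ?thesis by (simp add: poly_mapping_sum_singles)
  qed
  then have "z ` I \<subseteq> span ?B" using assms(2) by blast
  moreover have "card ?B < card I"
    using card_image_le[of "bounded_monomials n b" ?x] fin assms(3) by linarith
  ultimately show ?thesis using family_dependent[of I ?B z] assms(1) fin by blast
qed


lemma common_denominator:
  fixes xs :: "((nat \<Rightarrow>\<^sub>0 nat) \<Rightarrow>\<^sub>0 'k::field) fract list"
  assumes "\<And>x. x \<in> set xs \<Longrightarrow> \<exists>f\<in>polynomials_in n. \<exists>g\<in>polynomials_in n. g \<noteq> 0 \<and> x = Fract f g"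
  shows "\<exists>d b. d \<noteq> 0 \<and> d \<in> bounded_polynomials n b \<and>
    (\<forall>x\<in>set xs. \<exists>f\<in>bounded_polynomials n b. x = Fract f d)"
  using assms
proof (induction xs)
  case Nil
  then show ?case using one_bounded_polynomials[of n 0] by (intro exI[of _ 1] exI[of _ 0]) simp
next
  case (Cons x xs)
  then obtain d b where d: "d \<noteq> 0" "d \<in> bounded_polynomials n b"
    "\<And>y. y \<in> set xs \<Longrightarrow> \<exists>f\<in>bounded_polynomials n b. y = Fract f d" by auto
  obtain f g where fg: "f \<in> polynomials_in n" "g \<in> polynomials_in n" "g \<noteq> 0" "x = Fract f g"
    using Cons.prems[of x] by auto
  obtain bf bg where bfg: "f \<in> bounded_polynomials n bf" "g \<in> bounded_polynomials n bg"
    using fg polynomials_in_bounded by metis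
  define b' where "b' = b + (bf + bg)"
  have b': "p * q \<in> bounded_polynomials n b'"
    if "p \<in> bounded_polynomials n b" "q \<in> bounded_polynomials n c" "c \<le> bf + bg" for p q c
    using bounded_polynomials_mult[OF that(1,2)] bounded_polynomials_mono[of "b + c" b' n] that(3)
    unfolding b'_def by auto
  have "\<exists>f\<in>bounded_polynomials n b'. y = Fract f (d * g)" if y: "y \<in> set (x # xs)" for y
  proof (cases "y = x")
    case True
    then have "y = Fract (d * f) (d * g)" using fg d by (simp add: eq_fract)
    then show ?thesis using b'[OF d(2) bfg(1)] by auto
  next
    case False
    then obtain f' where f': "f' \<in> bounded_polynomials n b" "y = Fract f' d" using d(3) y by auto
    then have "y = Fract (f' * g) (d * g)" using fg d by (simp add: eq_fract)
    then show ?thesis using b'[OF f'(1) bfg(2)] by auto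
  qed
  then show ?case using d fg b'[OF d(2) bfg(2)] by (intro exI[of _ "d * g"] exI[of _ b']) auto
qed

lemma power_fract: "Fract (f :: 'a::idom) g ^ k = Fract (f ^ k) (g ^ k)"
  by (induction k) (simp_all add: One_fract_def)

text \<open>Padding each factor with powers of the common denominator \<open>d\<close> gives all monomials with
  exponents below \<open>N\<close> the same denominator, while the exponents in the numerators grow only linearly
  in \<open>N\<close>.\<close>

lemma power_product_numerator:
  fixes xs :: "((nat \<Rightarrow>\<^sub>0 nat) \<Rightarrow>\<^sub>0 'k::field) fract list"
  assumes d: "d \<noteq> 0" "d \<in> bounded_polynomials n b"
    and "length es = length xs" "set es \<subseteq> {..<N}"
    and "\<And>x. x \<in> set xs \<Longrightarrow> \<exists>f\<in>bounded_polynomials n b. x = Fract f d"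
  shows "\<exists>f\<in>bounded_polynomials n (length xs * (N * b)).
    power_product xs es = Fract f (d ^ (N * length xs))"
  using assms(3-)
proof (induction es xs rule: list_induct2)
  case Nil
  then show ?case using one_bounded_polynomials[of n 0] by (intro bexI[of _ 1]) (simp_all add: One_fract_def)
next
  case (Cons e es x xs)
  obtain f where f: "f \<in> bounded_polynomials n (length xs * (N * b))"
    "power_product xs es = Fract f (d ^ (N * length xs))"
    using Cons by auto
  obtain g where g: "g \<in> bounded_polynomials n b" "x = Fract g d"
    using Cons.prems by auto
  have e: "e \<le> N" using Cons.prems by auto
  have "g ^ e * d ^ (N - e) \<in> bounded_polynomials n (e * b + (N - e) * b)"
    by (intro bounded_polynomials_mult bounded_polynomials_power g d)
  then have g': "g ^ e * d ^ (N - e) \<in> bounded_polynomials n (N * b)"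
    using e by (simp flip: add_mult_distrib)
  have "d ^ N = d ^ e * d ^ (N - e)" using e by (simp flip: power_add)
  then have "x ^ e = Fract (g ^ e * d ^ (N - e)) (d ^ N)"
    using d by (simp add: g power_fract eq_fract mult_ac)
  then have "power_product (x # xs) (e # es) =
      Fract ((g ^ e * d ^ (N - e)) * f) (d ^ (N * length (x # xs)))"
    by (simp add: f power_add)
  moreover have "(g ^ e * d ^ (N - e)) * f \<in> bounded_polynomials n (length (x # xs) * (N * b))"
    using bounded_polynomials_mult[OF g' f(1)] by simp
  ultimately show ?case by blast
qed

text \<open>With all exponents below \<open>N\<close>, there are \<open>N ^ k\<close> monomials in \<open>k\<close> elements, while the space of
  their numerators has a dimension of order \<open>N ^ n\<close>. The former is larger once \<open>N\<close> exceeds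
  the constant \<open>M\<close> of this estimate.\<close>

lemma box_count:
  fixes n k b :: nat
  assumes "n < k"
  obtains N where "Suc (k * (N * b)) ^ n < N ^ k"
proof
  define M where "M = Suc (k * b) ^ n"
  have "Suc (k * (Suc M * b)) \<le> Suc M * Suc (k * b)" by (simp add: algebra_simps)
  then have "Suc (k * (Suc M * b)) ^ n \<le> (Suc M * Suc (k * b)) ^ n" by (rule power_mono) simp
  also have "\<dots> = Suc M ^ n * M" by (simp only: power_mult_distrib M_def)
  also have "\<dots> < Suc M ^ Suc n" by simp
  also have "\<dots> \<le> Suc M ^ k" using assms by (intro power_increasing) auto
  finally show "Suc (k * (Suc M * b)) ^ n < Suc M ^ k" .
qed

lemma reciprocal_sums_fractions:
  fixes T :: "'a::idom set"
  assumes "subring T ring_of_type_algebra" "x \<in> reciprocal_sums T"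
  shows "\<exists>f\<in>T. \<exists>g\<in>T. g \<noteq> 0 \<and> x = Fract f g"
  using assms(2)
proof induct
  note T = subringE[OF assms(1), simplified]
  case zero
  show ?case using T(2,3) by (intro bexI[of _ 0] bexI[of _ 1]) (simp_all add: Zero_fract_def)
next
  note T = subringE[OF assms(1), simplified]
  case (step x f)
  then obtain a b where ab: "a \<in> T" "b \<in> T" "b \<noteq> 0" "x = Fract a b" by blast
  then have "Fract 1 f + x = Fract (b + a * f) (f * b)" using step by simp
  then show ?case using ab step T(6,7) by (intro bexI[of _ "b + a * f"] bexI[of _ "f * b"]) auto
qed

lemma sum_Fract: "(\<Sum>i\<in>I. Fract (f i) (d :: 'a::idom)) = Fract (\<Sum>i\<in>I. f i) d" if "d \<noteq> 0"
proof (induction I rule: infinite_finite_induct)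
  case (insert i I)
  then show ?case using that by (simp add: eq_fract ring_distribs)
qed (simp_all add: fract_collapse)

text \<open>If \<open>k > n\<close>, then by counting the \<open>k\<close> elements chosen along the chain satisfy a polynomial relation
  over the ground field. A nonzero constant \<open>a\<close> is the reciprocal of the constant \<open>1/a\<close>, so it is a unit of
  the reciprocal complement and lies in no prime; this contradicts \<open>prime_chain_independent\<close>.\<close>

lemma prime_chain_length_le:
  fixes C :: "nat \<Rightarrow> ((nat \<Rightarrow>\<^sub>0 nat) \<Rightarrow>\<^sub>0 'k::field) fract set"
  assumes prime: "\<And>j. j \<le> k \<Longrightarrow> primeideal (C j) (reciprocal_complement (polynomials_in n))"
    and chain: "\<And>j. j < k \<Longrightarrow> C j \<subset> C (Suc j)"
  shows "k \<le> n"
proof (rule ccontr)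
  assume "\<not> k \<le> n"
  then have nk: "n < k" by simp
  define T where "T = (polynomials_in n :: ((nat \<Rightarrow>\<^sub>0 nat) \<Rightarrow>\<^sub>0 'k) set)"
  have T: "subring T ring_of_type_algebra" unfolding T_def by (rule subring_polynomials_in)
  let ?S = "reciprocal_sums T"
  have S: "subring ?S ring_of_type_algebra" by (rule subring_reciprocal_sums[OF T])
  have prime': "primeideal (C j) (subring_record ?S)" if "j \<le> k" for j
    using prime[OF that] unfolding T_def[symmetric] reciprocal_complement_eq[OF T] .
  note primes = prime'[unfolded primeideal_subring_record_iff[OF S]]
  have "\<exists>x. x \<in> C (Suc j) - C j" if "j < k" for j using chain[OF that] by blast
  then obtain x where x: "\<And>j. j < k \<Longrightarrow> x j \<in> C (Suc j) - C j" by metis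
  define xs where "xs = map x [0..<k]"
  have len: "length xs = k" by (simp add: xs_def)
  have "\<exists>f\<in>polynomials_in n. \<exists>g\<in>polynomials_in n. g \<noteq> 0 \<and> y = Fract f g" if y: "y \<in> set xs" for y
  proof -
    obtain j where j: "j < k" "y = x j" using y by (auto simp: xs_def)
    then have "y \<in> ?S" using x[of j] primes[of "Suc j"] by auto
    from reciprocal_sums_fractions[OF T this] show ?thesis unfolding T_def .
  qed
  from common_denominator[OF this] obtain d b where d: "d \<noteq> 0" "d \<in> bounded_polynomials n b"
    "\<And>y. y \<in> set xs \<Longrightarrow> \<exists>f\<in>bounded_polynomials n b. y = Fract f d" by blast
  obtain N where N: "Suc (k * (N * b)) ^ n < N ^ k" using box_count[OF nk] .
  define I where "I = {es. set es \<subseteq> {..<N} \<and> length es = k}"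
  have I: "finite I" "card I = N ^ k"
    unfolding I_def by (simp_all add: finite_lists_length_eq card_lists_length_eq)
  have "\<exists>f. f \<in> bounded_polynomials n (k * (N * b)) \<and> power_product xs es = Fract f (d ^ (N * k))"
    if "es \<in> I" for es
    using power_product_numerator[OF d(1,2), of es xs N] d(3) that len unfolding I_def by auto
  then obtain z where z: "\<And>es. es \<in> I \<Longrightarrow> z es \<in> bounded_polynomials n (k * (N * b))"
    "\<And>es. es \<in> I \<Longrightarrow> power_product xs es = Fract (z es) (d ^ (N * k))" by metis
  have "z ` I \<subseteq> bounded_polynomials n (k * (N * b))" using z(1) by blast
  from bounded_polynomials_dependent[OF I(1) this] N I(2)
  obtain c where c: "\<exists>es\<in>I. c es \<noteq> 0" "(\<Sum>es\<in>I. Poly_Mapping.single 0 (c es) * z es) = 0"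
    by auto
  define const where "const a = Fract (Poly_Mapping.single 0 a) (1 :: (nat \<Rightarrow>\<^sub>0 nat) \<Rightarrow>\<^sub>0 'k)" for a
  define E where "E = {es \<in> I. c es \<noteq> 0}"
  have "E = {}"
  proof (rule prime_chain_independent[OF S, of xs C E "\<lambda>es. const (c es)"])
    fix es assume "es \<in> E"
    then have es: "es \<in> I" "c es \<noteq> 0" by (auto simp: E_def)
    then show "length es = length xs" unfolding I_def len by blast
    have single: "Poly_Mapping.single 0 a \<in> T" for a
      unfolding T_def polynomials_in_def by (auto simp: split: if_splits)
    have single_nz: "Poly_Mapping.single (0::nat \<Rightarrow>\<^sub>0 nat) a \<noteq> 0" if "a \<noteq> 0" for a :: 'k
      using that by (metis lookup_single_eq lookup_zero)
    have const_eq: "const a = Fract 1 (Poly_Mapping.single 0 (inverse a))" if "a \<noteq> 0" for a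
      using that single_nz[of "inverse a"] by (simp add: const_def eq_fract mult_single)
    have const_S: "const a \<in> ?S" if "a \<noteq> 0" for a
      unfolding const_eq[OF that] using that by (intro reciprocal_in_sums single single_nz) simp
    have "const (inverse (c es)) * const (c es) = 1"
      using es(2) by (simp add: const_def mult_single One_fract_def)
    then have "const (c es) \<notin> C k"
      using primes[of k] const_S[of "inverse (c es)"] es(2) by force
    then show "const (c es) \<in> ?S - C (length xs)" using const_S es len by simp
  next
    have "(\<Sum>es\<in>E. const (c es) * power_product xs es) =
        (\<Sum>es\<in>I. const (c es) * power_product xs es)"
      by (rule sum.mono_neutral_left) (use I in \<open>auto simp: E_def const_def fract_collapse\<close>)
    also have "\<dots> = (\<Sum>es\<in>I. Fract (Poly_Mapping.single 0 (c es) * z es) (d ^ (N * k)))"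
      by (rule sum.cong) (simp_all add: const_def z(2))
    also have "\<dots> = 0"
      using d(1) by (simp add: sum_Fract c(2) fract_collapse)
    finally show "(\<Sum>es\<in>E. const (c es) * power_product xs es) \<in> C 0"
      using primes[of 0] by simp
  next
    show "xs ! j \<in> C (Suc j) - C j" if "j < length xs" for j
      using x[of j] that len by (simp add: xs_def)
    show "C j \<subseteq> C (Suc j)" if "j < length xs" for j
      using chain[of j] that len by auto
  qed (use prime' I len in \<open>auto simp: E_def\<close>)
  then show False using c(1) by (auto simp: E_def)
qed

section \<open>Substitution in polynomials\<close>

locale ring_map =
  fixes h :: "'a::comm_ring_1 \<Rightarrow> 'b::comm_ring_1"
  assumes one: "h 1 = 1"
    and add: "h (x + y) = h x + h y"
    and mult: "h (x * y) = h x * h y"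
begin

lemma zero: "h 0 = 0"
  using add[of 0 0] by simp

lemma diff: "h (x - y) = h x - h y"
  using add[of "x - y" y] by simp

lemma power: "h (x ^ k) = h x ^ k"
  by (induction k) (simp_all add: one mult)

lemma sum: "h (sum f I) = (\<Sum>i\<in>I. h (f i))"
  by (induction I rule: infinite_finite_induct) (simp_all add: zero add)

lemma prod: "h (prod f I) = (\<Prod>i\<in>I. h (f i))"
  by (induction I rule: infinite_finite_induct) (simp_all add: one mult)

end

definition monomial_value :: "(nat \<Rightarrow> 'b::comm_ring_1) \<Rightarrow> (nat \<Rightarrow>\<^sub>0 nat) \<Rightarrow> 'b"
  where "monomial_value y m = (\<Prod>j\<in>Poly_Mapping.keys m. y j ^ Poly_Mapping.lookup m j)"

text \<open>Evaluation of a polynomial at a family \<open>y\<close> of ring elements, with coefficients transported by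
  \<open>h\<close>; a ring map whenever \<open>h\<close> is one.\<close>

definition substitute :: "('k::comm_ring_1 \<Rightarrow> 'b::comm_ring_1) \<Rightarrow> (nat \<Rightarrow> 'b) \<Rightarrow> ((nat \<Rightarrow>\<^sub>0 nat) \<Rightarrow>\<^sub>0 'k) \<Rightarrow> 'b"
  where "substitute h y p = (\<Sum>m\<in>Poly_Mapping.keys p. h (Poly_Mapping.lookup p m) * monomial_value y m)"

lemma monomial_value_superset:
  assumes "finite A" "Poly_Mapping.keys m \<subseteq> A"
  shows "monomial_value y m = (\<Prod>j\<in>A. y j ^ Poly_Mapping.lookup m j)"
  unfolding monomial_value_def
  by (rule prod.mono_neutral_left) (use assms in \<open>auto simp: in_keys_iff\<close>)

lemma monomial_value_add: "monomial_value y (m + m') = monomial_value y m * monomial_value y m'"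
proof -
  let ?A = "Poly_Mapping.keys m \<union> Poly_Mapping.keys m'"
  show ?thesis
    using keys_add[of m m'] monomial_value_superset[of ?A m y] monomial_value_superset[of ?A m' y]
      monomial_value_superset[of ?A "m + m'" y]
    by (simp add: lookup_add power_add prod.distrib)
qed

context ring_map
begin

lemma substitute_superset:
  assumes "finite A" "Poly_Mapping.keys p \<subseteq> A"
  shows "substitute h y p = (\<Sum>m\<in>A. h (Poly_Mapping.lookup p m) * monomial_value y m)"
  unfolding substitute_def
  by (rule sum.mono_neutral_left) (use assms in \<open>auto simp: in_keys_iff zero\<close>)

lemma substitute_add: "substitute h y (p + q) = substitute h y p + substitute h y q"
proof -
  let ?A = "Poly_Mapping.keys p \<union> Poly_Mapping.keys q"
  show ?thesis
    using keys_add[of p q] substitute_superset[of ?A p y] substitute_superset[of ?A q y]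
      substitute_superset[of ?A "p + q" y]
    by (simp add: lookup_add add ring_distribs sum.distrib)
qed

lemma substitute_zero: "substitute h y 0 = 0"
  by (simp add: substitute_def)

lemma substitute_sum: "substitute h y (sum f I) = (\<Sum>i\<in>I. substitute h y (f i))"
  by (induction I rule: infinite_finite_induct) (simp_all add: substitute_zero substitute_add)

lemma substitute_single: "substitute h y (Poly_Mapping.single m c) = h c * monomial_value y m"
  by (simp add: substitute_def zero)

lemma substitute_mult: "substitute h y (p * q) = substitute h y p * substitute h y q"
proof -
  let ?s = "\<lambda>p m. Poly_Mapping.single m (Poly_Mapping.lookup p m)"
  have "p * q = (\<Sum>m\<in>Poly_Mapping.keys p. ?s p m) * (\<Sum>m'\<in>Poly_Mapping.keys q. ?s q m')"
    by (simp add: poly_mapping_sum_singles)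
  also have "\<dots> = (\<Sum>m\<in>Poly_Mapping.keys p. \<Sum>m'\<in>Poly_Mapping.keys q.
      Poly_Mapping.single (m + m') (Poly_Mapping.lookup p m * Poly_Mapping.lookup q m'))"
    by (simp add: sum_product mult_single)
  finally show ?thesis
    by (simp add: substitute_sum substitute_single monomial_value_add mult substitute_def[of h y p]
        substitute_def[of h y q] sum_product mult_ac)
qed

lemma ring_map_substitute: "ring_map (substitute h y)"
proof
  show "substitute h y 1 = 1"
    using substitute_single[of y 0 1] by (simp add: one monomial_value_def)
qed (simp_all add: substitute_add substitute_mult)

end

abbreviation const :: "'k::comm_ring_1 \<Rightarrow> (nat \<Rightarrow>\<^sub>0 nat) \<Rightarrow>\<^sub>0 'k"
  where "const \<equiv> Poly_Mapping.single 0"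

definition var :: "nat \<Rightarrow> (nat \<Rightarrow>\<^sub>0 nat) \<Rightarrow>\<^sub>0 'k::comm_ring_1"
  where "var j = Poly_Mapping.single (Poly_Mapping.single j 1) 1"

lemma (in ring_map) substitute_const: "substitute h y (const c) = h c"
  by (simp add: substitute_single monomial_value_def)

lemma (in ring_map) substitute_var: "substitute h y (var j) = y j"
  by (simp add: var_def substitute_single one monomial_value_def)

lemma ring_map_const: "ring_map const"
proof
  show "const (x * y) = const x * const y" for x y :: 'a
    using mult_single[of 0 x "0 :: nat \<Rightarrow>\<^sub>0 nat" y] by simp
qed (simp_all add: single_add)

text \<open>All identities between substitutions below reduce to comparing images of the variables by this
  lemma.\<close>

lemma (in ring_map) comp_substitute: "h (substitute g y p) = substitute (\<lambda>c. h (g c)) (\<lambda>j. h (y j)) p"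
  by (simp add: substitute_def monomial_value_def sum mult prod power)

lemma substitute_const_var: "substitute const var p = (p :: (nat \<Rightarrow>\<^sub>0 nat) \<Rightarrow>\<^sub>0 'k::comm_ring_1)"
proof -
  have pow: "(var j :: (nat \<Rightarrow>\<^sub>0 nat) \<Rightarrow>\<^sub>0 'k) ^ e = Poly_Mapping.single (Poly_Mapping.single j e) 1" for j e
    by (induction e) (simp_all add: var_def mult_single flip: single_add)
  have "(\<Prod>j\<in>A. Poly_Mapping.single (f j) (1::'k)) = Poly_Mapping.single (\<Sum>j\<in>A. f j) 1"
    for A :: "nat set" and f :: "nat \<Rightarrow> nat \<Rightarrow>\<^sub>0 nat"
    by (induction A rule: infinite_finite_induct) (simp_all add: mult_single)
  then have "monomial_value var m = Poly_Mapping.single m (1::'k)" for m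
    by (simp add: monomial_value_def pow poly_mapping_sum_singles)
  then show ?thesis by (simp add: substitute_def mult_single poly_mapping_sum_singles)
qed

section \<open>Degrees in twisted coordinates\<close>

text \<open>The change of coordinates that sends \<open>X\<^sub>1 + X\<^sub>n\<^sup>k\<close> to \<open>X\<^sub>1\<close> and fixes the other variables, for
  \<open>n \<noteq> 1\<close>.\<close>

definition twist :: "nat \<Rightarrow> nat \<Rightarrow> ((nat \<Rightarrow>\<^sub>0 nat) \<Rightarrow>\<^sub>0 'k::comm_ring_1) \<Rightarrow> ((nat \<Rightarrow>\<^sub>0 nat) \<Rightarrow>\<^sub>0 'k)"
  where "twist n k = substitute const (\<lambda>j. if j = 1 then var 1 - var n ^ k else var j)"

text \<open>Multiplying each variable of index greater than \<open>s\<close> by a new variable \<open>t\<close> makes the degree of a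
  polynomial in the variables of index greater than \<open>s\<close> its degree in \<open>t\<close>. Univariate polynomials over
  a domain then supply the laws of a degree function.\<close>

definition grading :: "nat \<Rightarrow> ((nat \<Rightarrow>\<^sub>0 nat) \<Rightarrow>\<^sub>0 'k::comm_ring_1) \<Rightarrow> ((nat \<Rightarrow>\<^sub>0 nat) \<Rightarrow>\<^sub>0 'k) poly"
  where "grading s = substitute (\<lambda>c. [:const c:]) (\<lambda>j. monom (var j) (if j \<le> s then 0 else 1))"

definition twisted_degree :: "nat \<Rightarrow> nat \<Rightarrow> nat \<Rightarrow> ((nat \<Rightarrow>\<^sub>0 nat) \<Rightarrow>\<^sub>0 'k::comm_ring_1) \<Rightarrow> nat"
  where "twisted_degree n k s f = degree (grading s (twist n k f))"

lemma ring_map_const_poly: "ring_map (\<lambda>a. [:a:])"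
  by unfold_locales (simp_all add: one_pCons)

lemma ring_map_const_const: "ring_map (\<lambda>c. [:const c:])"
  by unfold_locales (simp_all add: one_pCons ring_map.add[OF ring_map_const] ring_map.mult[OF ring_map_const])

lemma ring_map_poly: "ring_map (\<lambda>p. poly p x)"
  by unfold_locales simp_all

lemma ring_map_twist: "ring_map (twist n k)"
  unfolding twist_def by (rule ring_map.ring_map_substitute[OF ring_map_const])

lemma ring_map_grading: "ring_map (grading s)"
  unfolding grading_def by (rule ring_map.ring_map_substitute[OF ring_map_const_const])

lemma grading_var: "grading s (var j) = monom (var j) (if j \<le> s then 0 else 1)"
  unfolding grading_def by (rule ring_map.substitute_var[OF ring_map_const_const])

lemma twist_var: "twist n k (var j) = (if j = 1 then var 1 - var n ^ k else var j)"
  unfolding twist_def by (rule ring_map.substitute_var[OF ring_map_const])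

lemma poly_grading:
  "poly (grading s p) t = substitute const (\<lambda>j. var j * t ^ (if j \<le> s then 0 else 1)) p"
  unfolding grading_def
  by (subst ring_map.comp_substitute[OF ring_map_poly]) (simp add: poly_monom)

lemma poly_grading_1: "poly (grading s p) 1 = p"
  using substitute_const_var[of p] by (simp add: poly_grading)

text \<open>The substitution of \<open>X\<^sub>1 + X\<^sub>n\<^sup>k\<close> for \<open>X\<^sub>1\<close> is a left inverse of the twist.\<close>

lemma twist_eq_0D:
  assumes "n \<noteq> 1" "twist n k f = 0"
  shows "f = 0"
proof -
  define untwist where "untwist = substitute const (\<lambda>j. if j = 1 then var 1 + var n ^ k else (var j :: (nat \<Rightarrow>\<^sub>0 nat) \<Rightarrow>\<^sub>0 'a))"
  have untwist: "ring_map untwist"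
    unfolding untwist_def by (rule ring_map.ring_map_substitute[OF ring_map_const])
  have v: "untwist (var j) = (if j = 1 then var 1 + var n ^ k else var j)" for j
    unfolding untwist_def by (rule ring_map.substitute_var[OF ring_map_const])
  have c: "untwist (const c) = const c" for c
    unfolding untwist_def by (rule ring_map.substitute_const[OF ring_map_const])
  have img: "untwist (if j = 1 then var 1 - var n ^ k else var j) = var j" for j
    using assms(1) v[of j] v[of 1] v[of n]
    by (simp add: ring_map.diff[OF untwist] ring_map.power[OF untwist])
  have "untwist (twist n k f) = substitute const var f"
    unfolding twist_def by (subst ring_map.comp_substitute[OF untwist]) (simp only: c img)
  then have "untwist (twist n k f) = f" by (simp add: substitute_const_var)
  then show ?thesis using assms(2) ring_map.zero[OF untwist] by simp
qed

lemma degree_function_twisted: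
  assumes "n \<noteq> 1"
  shows "degree_function (twisted_degree n k s :: ((nat \<Rightarrow>\<^sub>0 nat) \<Rightarrow>\<^sub>0 'k::idom) \<Rightarrow> nat)"
proof
  fix f g :: "(nat \<Rightarrow>\<^sub>0 nat) \<Rightarrow>\<^sub>0 'k"
  note maps = ring_map_twist[of n k] ring_map_grading[of s]
  show "twisted_degree n k s (0 :: (nat \<Rightarrow>\<^sub>0 nat) \<Rightarrow>\<^sub>0 'k) = 0"
    by (simp add: twisted_degree_def maps[THEN ring_map.zero])
  show "twisted_degree n k s (f + g) \<le> max (twisted_degree n k s f) (twisted_degree n k s g)"
    by (simp add: twisted_degree_def maps[THEN ring_map.add] degree_add_le_max)
  assume "f \<noteq> 0" "g \<noteq> 0"
  have "grading s (twist n k f) \<noteq> 0" if "f \<noteq> 0" for f :: "(nat \<Rightarrow>\<^sub>0 nat) \<Rightarrow>\<^sub>0 'k"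
    using that twist_eq_0D[OF assms, of k f] poly_grading_1[of s "twist n k f"] by auto
  then show "twisted_degree n k s (f * g) = twisted_degree n k s f + twisted_degree n k s g"
    using \<open>f \<noteq> 0\<close> \<open>g \<noteq> 0\<close>
    by (simp add: twisted_degree_def maps[THEN ring_map.mult] degree_mult_eq)
qed

text \<open>Let \<open>p\<close> be the twist of \<open>f\<close>. If its grading of level \<open>s\<close> is a constant polynomial, then comparing
  the values at \<open>1\<close> and \<open>0\<close> shows that \<open>p\<close> does not change when the variables of index greater than \<open>s\<close> are set to \<open>0\<close>.
  Hence \<open>p\<close> is a polynomial in variables of index at most \<open>s\<close>, and for every level from \<open>s\<close> onwards the
  grading leaves these variables unscaled.\<close>

lemma twisted_degree_eq_0_mono:
  assumes "s \<le> t" "twisted_degree n k s f = 0"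
  shows "twisted_degree n k t f = 0"
proof -
  define p where "p = twist n k f"
  define low where "low = (\<lambda>j. if j \<le> s then var j else (0 :: (nat \<Rightarrow>\<^sub>0 nat) \<Rightarrow>\<^sub>0 'a))"
  obtain a where a: "grading s p = [:a:]"
    using assms(2) degree_0_id[of "grading s p"] unfolding twisted_degree_def p_def by metis
  have "poly (grading s p) 0 = poly (grading s p) 1" by (simp add: a)
  moreover have "(\<lambda>j. var j * 0 ^ (if j \<le> s then 0 else 1)) = low" by (auto simp: low_def)
  ultimately have p: "p = substitute const low p"
    using poly_grading[of s p 0] poly_grading_1[of s p] by simp
  have "grading t (low j) = [:low j:]" for j
    using assms(1) by (simp add: low_def grading_var monom_0 ring_map.zero[OF ring_map_grading])
  moreover have "grading t (const c) = [:const c:]" for c :: 'a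
    unfolding grading_def by (rule ring_map.substitute_const[OF ring_map_const_const])
  ultimately have "grading t (substitute const low p) = substitute (\<lambda>c. [:const c:]) (\<lambda>j. [:low j:]) p"
    by (subst ring_map.comp_substitute[OF ring_map_grading]) simp
  also have "\<dots> = [:substitute const low p:]"
    by (subst ring_map.comp_substitute[OF ring_map_const_poly]) simp
  finally show ?thesis using p unfolding twisted_degree_def p_def[symmetric] by (metis degree_pCons_0)
qed

text \<open>The preimages of the variables under the twist: the new coordinates.\<close>

definition twisted_var :: "nat \<Rightarrow> nat \<Rightarrow> nat \<Rightarrow> (nat \<Rightarrow>\<^sub>0 nat) \<Rightarrow>\<^sub>0 'k::comm_ring_1"
  where "twisted_var n k j = (if j = 1 then var 1 + var n ^ k else var j)"

lemma twist_twisted_var: "n \<noteq> 1 \<Longrightarrow> twist n k (twisted_var n k j) = var j"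
  by (simp add: twisted_var_def twist_var ring_map.add[OF ring_map_twist] ring_map.power[OF ring_map_twist])

lemma var_nonzero: "(var j :: (nat \<Rightarrow>\<^sub>0 nat) \<Rightarrow>\<^sub>0 'k::comm_ring_1) \<noteq> 0"
  unfolding var_def by (metis lookup_single_eq lookup_zero zero_neq_one)

lemma twisted_var_nonzero: "n \<noteq> 1 \<Longrightarrow> twisted_var n k j \<noteq> 0"
  using twist_twisted_var[of n k j] ring_map.zero[OF ring_map_twist] var_nonzero by metis

lemma twisted_degree_twisted_var:
  "n \<noteq> 1 \<Longrightarrow> twisted_degree n k s (twisted_var n k j :: (nat \<Rightarrow>\<^sub>0 nat) \<Rightarrow>\<^sub>0 'k::comm_ring_1) = (if j \<le> s then 0 else 1)"
  by (simp add: twisted_degree_def twist_twisted_var grading_var degree_monom_eq var_nonzero del: One_nat_def)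

lemma twisted_var_in:
  assumes "1 \<le> j" "j \<le> n"
  shows "(twisted_var n k j :: (nat \<Rightarrow>\<^sub>0 nat) \<Rightarrow>\<^sub>0 'k::comm_ring_1) \<in> polynomials_in n"
proof -
  note T = subringE[OF subring_polynomials_in[where ?'k = 'k and n = n], simplified]
  have v: "(var i :: (nat \<Rightarrow>\<^sub>0 nat) \<Rightarrow>\<^sub>0 'k) \<in> polynomials_in n" if "1 \<le> i" "i \<le> n" for i
    using that by (simp add: var_def polynomials_in_def)
  have "(var n :: (nat \<Rightarrow>\<^sub>0 nat) \<Rightarrow>\<^sub>0 'k) ^ e \<in> polynomials_in n" for e
    using v[of n] assms by (induction e) (auto intro: T(3,6))
  then show ?thesis
    using v[of 1] v[of j] T(7) assms unfolding twisted_var_def by auto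
qed

text \<open>In the coordinates of \<open>l\<close>, the element \<open>X\<^sub>1 + X\<^sub>n\<^sup>k\<close> becomes \<open>X\<^sub>1 - X\<^sub>n\<^sup>l + X\<^sub>n\<^sup>k\<close>, whose term
  \<open>X\<^sub>n\<^sup>k\<close> has degree \<open>k\<close> and is not cancelled.\<close>

lemma twisted_degree_other_var:
  assumes "1 \<le> s" "s < n" "k \<noteq> l" "0 < k"
  shows "0 < twisted_degree n l s (twisted_var n k 1 :: (nat \<Rightarrow>\<^sub>0 nat) \<Rightarrow>\<^sub>0 'k::idom)"
proof -
  let ?p = "grading s (twist n l (twisted_var n k 1)) :: ((nat \<Rightarrow>\<^sub>0 nat) \<Rightarrow>\<^sub>0 'k) poly"
  have "twist n l (twisted_var n k 1) = var 1 - var n ^ l + (var n ^ k :: (nat \<Rightarrow>\<^sub>0 nat) \<Rightarrow>\<^sub>0 'k)"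
    using assms by (simp add: twisted_var_def twist_var ring_map.add[OF ring_map_twist]
      ring_map.power[OF ring_map_twist])
  then have "?p = monom (var 1) 0 - monom (var n ^ l) l + monom (var n ^ k) k"
    using assms by (simp add: ring_map.add[OF ring_map_grading] ring_map.diff[OF ring_map_grading]
      ring_map.power[OF ring_map_grading] grading_var monom_power)
  then have "coeff ?p k = var n ^ k" using assms by simp
  then have "coeff ?p k \<noteq> 0" using var_nonzero[of n, where ?'k = 'k] by simp
  then show ?thesis using le_degree[of ?p k] assms(4) unfolding twisted_degree_def by linarith
qed

section \<open>Infinitely many primes of each height\<close>

text \<open>Any chain that ends in \<open>D i\<close> can be continued by \<open>D (i + 1), \<dots>, D n\<close>. The result has length at most
  \<open>n\<close>, so the chain that ends in \<open>D i\<close> has length at most \<open>i\<close>.\<close>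

lemma ideal_height_in_longest_chain:
  assumes prime: "\<And>j. j \<le> n \<Longrightarrow> primeideal (D j) R"
    and chain: "\<And>j. j < n \<Longrightarrow> D j \<subset> D (Suc j)"
    and longest: "\<And>C k. (\<And>j. j \<le> k \<Longrightarrow> primeideal (C j) R) \<Longrightarrow> (\<And>j. j < k \<Longrightarrow> C j \<subset> C (Suc j)) \<Longrightarrow> k \<le> n"
    and "i \<le> n"
  shows "ideal_height R (D i) = enat i"
  unfolding ideal_height_def
proof (rule antisym)
  have "\<forall>j\<le>i. primeideal (D j) R" "\<forall>j<i. D j \<subset> D (Suc j)"
    using prime chain \<open>i \<le> n\<close> by (metis order_trans, metis less_le_trans)
  then show "enat i \<le> (SUP k \<in> {k. \<exists>C. (\<forall>j\<le>k. primeideal (C j) R) \<and> (\<forall>j<k. C j \<subset> C (Suc j)) \<and> C k = D i}. enat k)"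
    by (intro SUP_upper CollectI exI[of _ D]) simp
  show "(SUP k \<in> {k. \<exists>C. (\<forall>j\<le>k. primeideal (C j) R) \<and> (\<forall>j<k. C j \<subset> C (Suc j)) \<and> C k = D i}. enat k) \<le> enat i"
  proof (rule SUP_least)
    fix k assume "k \<in> {k. \<exists>C. (\<forall>j\<le>k. primeideal (C j) R) \<and> (\<forall>j<k. C j \<subset> C (Suc j)) \<and> C k = D i}"
    then obtain C where C: "\<And>j. j \<le> k \<Longrightarrow> primeideal (C j) R" "\<And>j. j < k \<Longrightarrow> C j \<subset> C (Suc j)" "C k = D i"
      by auto
    define C' where "C' j = (if j \<le> k then C j else D (i + (j - k)))" for j
    have "k + (n - i) \<le> n"
    proof (rule longest[of _ C'])
      show "primeideal (C' j) R" if "j \<le> k + (n - i)" for j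
        using that C(1)[of j] prime[of "i + (j - k)"] \<open>i \<le> n\<close> by (auto simp: C'_def)
      show "C' j \<subset> C' (Suc j)" if "j < k + (n - i)" for j
      proof (cases "j < k")
        case True
        then show ?thesis using C(2)[of j] by (simp add: C'_def)
      next
        case False
        then have "C' j = D (i + (j - k))" "C' (Suc j) = D (Suc (i + (j - k)))"
          using C(3) by (auto simp: C'_def Suc_diff_le)
        then show ?thesis using chain[of "i + (j - k)"] that False \<open>i \<le> n\<close> by simp
      qed
    qed
    then show "enat k \<le> enat i" using \<open>i \<le> n\<close> by simp
  qed
qed

lemma primeideal_zero:
  fixes S :: "'a::idom set"
  assumes "subring S ring_of_type_algebra"
  shows "primeideal {0} (subring_record S)"
  using subringE(2)[OF assms] unfolding primeideal_subring_record_iff[OF assms] by simp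

definition twisted_prime :: "nat \<Rightarrow> nat \<Rightarrow> nat \<Rightarrow> ((nat \<Rightarrow>\<^sub>0 nat) \<Rightarrow>\<^sub>0 'k::field) fract set"
  where "twisted_prime n k s = degree_function.centre (twisted_degree n k s) (polynomials_in n)"

lemma primeideal_twisted_prime:
  "n \<noteq> 1 \<Longrightarrow> primeideal (twisted_prime n k s) (reciprocal_complement (polynomials_in n))"
  unfolding twisted_prime_def
  by (rule degree_function.primeideal_centre[OF degree_function_twisted subring_polynomials_in])

lemma reciprocal_in_twisted_prime_iff:
  "n \<noteq> 1 \<Longrightarrow> f \<in> polynomials_in n \<Longrightarrow> f \<noteq> 0 \<Longrightarrow>
    Fract 1 f \<in> twisted_prime n k s \<longleftrightarrow> 0 < twisted_degree n k s f"
  unfolding twisted_prime_def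
  by (rule degree_function.reciprocal_in_centre_iff[OF degree_function_twisted])

lemma ideal_height_twisted_prime:
  fixes n k i :: nat
  assumes "n \<noteq> 1" "1 \<le> i" "i \<le> n"
  shows "ideal_height (reciprocal_complement (polynomials_in n))
    (twisted_prime n k (n - i) :: ((nat \<Rightarrow>\<^sub>0 nat) \<Rightarrow>\<^sub>0 'k::field) fract set) = enat i"
proof -
  let ?R = "reciprocal_complement (polynomials_in n :: ((nat \<Rightarrow>\<^sub>0 nat) \<Rightarrow>\<^sub>0 'k) set)"
  let ?Q = "\<lambda>s. twisted_prime n k s :: ((nat \<Rightarrow>\<^sub>0 nat) \<Rightarrow>\<^sub>0 'k) fract set"
  let ?v = "\<lambda>j. twisted_var n k j :: (nat \<Rightarrow>\<^sub>0 nat) \<Rightarrow>\<^sub>0 'k"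
  note T = subring_polynomials_in[of n, where ?'k = 'k]
  note S = subring_reciprocal_sums[OF T]
  define D where "D j = (if j = 0 then {0} else ?Q (n - j))" for j
  have prime: "primeideal (D j) ?R" for j
  proof (cases "j = 0")
    case True
    then show ?thesis using primeideal_zero[OF S] by (simp add: D_def reciprocal_complement_eq[OF T])
  next
    case False
    then show ?thesis unfolding D_def by (simp add: primeideal_twisted_prime[OF assms(1)])
  qed
  have mem: "Fract 1 (?v j) \<in> ?Q s \<longleftrightarrow> s < j" if j: "1 \<le> j" "j \<le> n" for j s
  proof -
    have v: "?v j \<in> polynomials_in n" "?v j \<noteq> 0"
      using twisted_var_in[OF j] twisted_var_nonzero[OF assms(1)] by blast+
    show ?thesis
      using reciprocal_in_twisted_prime_iff[OF assms(1) v, of k s]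
        twisted_degree_twisted_var[OF assms(1), of k s j, where ?'k = 'k]
      by (auto split: if_splits)
  qed
  have chain: "D j \<subset> D (Suc j)" if "j < n" for j
  proof
    let ?x = "Fract 1 (?v (n - j))"
    have "?x \<noteq> 0"
      using twisted_var_nonzero[OF assms(1), of k "n - j", where ?'a = 'k]
      by (simp add: Zero_fract_def eq_fract)
    then have "?x \<in> D (Suc j) - D j" using mem[of "n - j"] that
      by (cases "j = 0") (auto simp: D_def diff_less_mono2)
    then show "D j \<noteq> D (Suc j)" by blast
    show "D j \<subseteq> D (Suc j)"
    proof (cases "j = 0")
      case True
      then show ?thesis
        using prime[of "Suc j"]
        unfolding reciprocal_complement_eq[OF T] primeideal_subring_record_iff[OF S]
        by (simp add: D_def)
    next
      case False
      have "?Q (n - j) \<subseteq> ?Q (n - Suc j)"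
        unfolding twisted_prime_def
        by (rule centre_antimono[OF degree_function_twisted degree_function_twisted, OF assms(1) assms(1)])
          (rule twisted_degree_eq_0_mono[of "n - Suc j" "n - j"], simp_all)
      then show ?thesis using False by (simp add: D_def)
    qed
  qed
  have "ideal_height ?R (D i) = enat i"
  proof (rule ideal_height_in_longest_chain[where n = n])
    show "m \<le> n" if "\<And>j. j \<le> m \<Longrightarrow> primeideal (C j) ?R" "\<And>j. j < m \<Longrightarrow> C j \<subset> C (Suc j)" for C m
      by (rule prime_chain_length_le[where k = m and C = C]) (use that in auto)
  qed (use prime chain assms(3) in auto)
  then show ?thesis using assms(2) by (simp add: D_def)
qed

text \<open>The reciprocal of \<open>X\<^sub>1 + X\<^sub>n\<^sup>k\<close> separates the prime of \<open>k\<close> from all the others. The hypothesis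
  \<open>1 \<le> s\<close> makes \<open>X\<^sub>1 + X\<^sub>n\<^sup>k\<close> a coordinate of degree \<open>0\<close> for \<open>k\<close>, and \<open>s < n\<close> gives it positive degree
  for the other exponents.\<close>

lemma inj_on_twisted_prime:
  assumes "1 \<le> s" "s < n"
  shows "inj_on (\<lambda>k. twisted_prime n k s :: ((nat \<Rightarrow>\<^sub>0 nat) \<Rightarrow>\<^sub>0 'k::field) fract set) {1..}"
proof (rule inj_onI, rule ccontr)
  fix k l :: nat
  assume kl: "k \<in> {1..}" "l \<in> {1..}" "k \<noteq> l" and
    eq: "twisted_prime n k s = (twisted_prime n l s :: ((nat \<Rightarrow>\<^sub>0 nat) \<Rightarrow>\<^sub>0 'k) fract set)"
  let ?v = "twisted_var n k 1 :: (nat \<Rightarrow>\<^sub>0 nat) \<Rightarrow>\<^sub>0 'k"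
  have n: "n \<noteq> 1" using assms by simp
  have v: "?v \<in> polynomials_in n" "?v \<noteq> 0"
    using twisted_var_in[of 1 n] twisted_var_nonzero[OF n] assms by auto
  have "Fract 1 ?v \<in> twisted_prime n l s"
    using reciprocal_in_twisted_prime_iff[OF n v] twisted_degree_other_var[OF assms kl(3)] kl by simp
  moreover have "Fract 1 ?v \<notin> twisted_prime n k s"
    using reciprocal_in_twisted_prime_iff[OF n v] twisted_degree_twisted_var[OF n, of k s 1, where ?'k = 'k]
      assms by simp
  ultimately show False using eq by simp
qed

theorem theorem6p6:
  fixes n i :: nat
    and R :: "((nat \<Rightarrow>\<^sub>0 nat) \<Rightarrow>\<^sub>0 'k::field) fract ring"
  defines "R \<equiv> reciprocal_complement (polynomials_in n :: ((nat \<Rightarrow>\<^sub>0 nat) \<Rightarrow>\<^sub>0 'k) set)"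
  assumes "n \<ge> 1"
    and "1 \<le> i" and "i \<le> n - 1"
  shows "infinite {P. primeideal P R \<and> ideal_height R P = enat i}"
proof
  assume fin: "finite {P. primeideal P R \<and> ideal_height R P = enat i}"
  let ?Q = "\<lambda>k. twisted_prime n k (n - i) :: ((nat \<Rightarrow>\<^sub>0 nat) \<Rightarrow>\<^sub>0 'k) fract set"
  have n: "n \<noteq> 1" "i \<le> n" "1 \<le> n - i" "n - i < n" using assms by auto
  have "?Q ` {1..} \<subseteq> {P. primeideal P R \<and> ideal_height R P = enat i}"
    unfolding R_def
    using primeideal_twisted_prime[OF n(1)] ideal_height_twisted_prime[OF n(1) assms(3) n(2)] by blast
  then have "finite (?Q ` {1..})" using fin finite_subset by blast
  then have "finite {1::nat..}" using finite_imageD inj_on_twisted_prime[OF n(3,4)] by blast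
  then show False using infinite_Ici by blast
qed

end
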